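(* Let $q$ be a complex number with $|q|<1$. Then $$\sum_{k=0}^{\infty}q^{6k^2}\frac{(q;q^2)_k^6}{(q^2;q^2)_{2k}^3}\left\{\lambda_q(k)\sum_{i=1}^{2k}\frac{q^{2i}}{[2i]^2}-\mu_q(k)\sum_{i=1}^{k}\frac{q^{2i-1}}{[2i-1]^2}-\nu_q(k)(1-q)q^{1+6k}\right\}$$ $$=\frac{(q,q^3;q^2)_{\infty}}{(q^2;q^2)_{\infty}^2}\left\{\sum_{j=1}^{\infty}\frac{q^{2j}}{[2j]^2}-\frac{3(1+q)^3}{64}\sum_{j=1}^{\infty}\frac{q^{2j-1}}{[2j-1]^2}\right\},$$ where $$\lambda_q(k)=\frac{1+2q^{1+2k}-q^{1+6k}(2+2q^2+q^{1+2k}+q^{3+2k}-3q^{3+6k})}{(1-q)(1-q^{1+2k})(1+q^{1+2k})^3},$$ $$\mu_q(k)=\frac{1+3q^{1+2k}+3q^{2+4k}-2q^{1+6k}+q^{3+6k}-3q^{2+8k}-3q^{3+10k}}{64(1-q)(1+q^{1+2k})^3(137+27q+27q^2+9q^3)^{-1}},$$ $$\nu_q(k)=\frac{3(1+q)^3(1+2q^{1+2k}+3q^{2+4k})}{64(1-q^{1+2k})(1+q^{1+2k})^3}-\frac{q^{1+2k}(1+q^{1+2k}+q^{2+4k})^2}{(1-q^{1+2k})(1+q^{1+2k})^5}.$$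
   Context: For complex $x$ and $p$ with $|p|<1$, the $q$-shifted factorials with base $p$ are $(x;p)_{\infty}=\prod_{i=0}^{\infty}(1-xp^i)$ and, for an integer $n\ge 0$, $(x;p)_n=(x;p)_\infty/(xp^n;p)_\infty$, i.e. $(x;p)_n=\prod_{i=0}^{n-1}(1-xp^i)$. The compact notation $(x_1,\dots,x_r;p)_m=(x_1;p)_m\cdots(x_r;p)_m$ is used for $m$ a nonnegative integer or $\infty$. A power such as $(x;p)_m^6$ means $((x;p)_m)^6$. The $q$-integer is $[n]=1+q+\cdots+q^{n-1}$. Empty sums are $0$. In $\mu_q(k)$, the factor $(137+27q+27q^2+9q^3)^{-1}$ in the denominator amounts to multiplying the numerator by $137+27q+27q^2+9q^3$. *)

theory Defs
  imports "HOL-Analysis.Analysis"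
begin

definition qpoch :: "complex \<Rightarrow> complex \<Rightarrow> nat \<Rightarrow> complex" where
  "qpoch x p n = (\<Prod>i<n. 1 - x * p ^ i)"

definition qpoch_inf :: "complex \<Rightarrow> complex \<Rightarrow> complex" where
  "qpoch_inf x p = (\<Prod>i. 1 - x * p ^ i)"

definition qint :: "complex \<Rightarrow> nat \<Rightarrow> complex" where
  "qint q n = (\<Sum>i<n. q ^ i)"

definition lambda_q :: "complex \<Rightarrow> nat \<Rightarrow> complex" where
  "lambda_q q k =
     (1 + 2 * q ^ (1 + 2*k)
        - q ^ (1 + 6*k) * (2 + 2 * q ^ 2 + q ^ (1 + 2*k) + q ^ (3 + 2*k) - 3 * q ^ (3 + 6*k)))
     / ((1 - q) * (1 - q ^ (1 + 2*k)) * (1 + q ^ (1 + 2*k)) ^ 3)"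

definition mu_q :: "complex \<Rightarrow> nat \<Rightarrow> complex" where
  "mu_q q k =
     (1 + 3 * q ^ (1 + 2*k) + 3 * q ^ (2 + 4*k) - 2 * q ^ (1 + 6*k) + q ^ (3 + 6*k)
        - 3 * q ^ (2 + 8*k) - 3 * q ^ (3 + 10*k))
     / (64 * (1 - q) * (1 + q ^ (1 + 2*k)) ^ 3
          * inverse (137 + 27 * q + 27 * q ^ 2 + 9 * q ^ 3))"

definition nu_q :: "complex \<Rightarrow> nat \<Rightarrow> complex" where
  "nu_q q k =
     (3 * (1 + q) ^ 3 * (1 + 2 * q ^ (1 + 2*k) + 3 * q ^ (2 + 4*k)))
       / (64 * (1 - q ^ (1 + 2*k)) * (1 + q ^ (1 + 2*k)) ^ 3)
     - (q ^ (1 + 2*k) * (1 + q ^ (1 + 2*k) + q ^ (2 + 4*k)) ^ 2)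
       / ((1 - q ^ (1 + 2*k)) * (1 + q ^ (1 + 2*k)) ^ 5)"

text \<open>
  For \<open>norm q < 1\<close> the infinite products and series below converge, and the \<open>q\<close>-integers
  and \<open>q\<close>-shifted factorials occurring as denominators are nonzero.
\<close>

lemma convergent_qpoch_inf:
  fixes x p :: complex
  assumes "norm p < 1"
  shows "convergent_prod (\<lambda>i. 1 - x * p ^ i)"
proof -
  have "summable (\<lambda>i. norm x * norm p ^ i)"
    using assms by (intro summable_mult summable_geometric) auto
  hence "summable (\<lambda>i. norm ((1 - x * p ^ i) - 1))"
    by (simp add: norm_mult norm_power)
  thus ?thesis
    by (intro abs_convergent_prod_imp_convergent_prod summable_imp_abs_convergent_prod)
qed

lemma power_neq_one:
  fixes q :: complex
  assumes "norm q < 1" "n > 0"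
  shows "q ^ n \<noteq> 1" "q ^ n \<noteq> - 1"
proof -
  have "norm (q ^ n) < 1"
    using assms by (simp add: norm_power power_less_one_iff)
  thus "q ^ n \<noteq> 1" "q ^ n \<noteq> - 1" by auto
qed

lemma qint_conv:
  assumes "norm q < 1"
  shows "qint q n = (1 - q ^ n) / (1 - q)"
proof -
  have "q \<noteq> 1" using assms by auto
  thus ?thesis by (simp add: qint_def sum_gp_strict)
qed

lemma qint_nonzero:
  assumes "norm q < 1" "n > 0"
  shows "qint q n \<noteq> 0"
  using assms power_neq_one[of q n] by (auto simp: qint_conv)

lemma qpoch_denominator_nonzero:
  assumes "norm q < 1"
  shows "qpoch (q ^ 2) (q ^ 2) n \<noteq> 0"
proof -
  have "1 - q ^ 2 * (q ^ 2) ^ i \<noteq> 0" for i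
    using power_neq_one(1)[OF assms, of "2 + 2 * i"] by (simp only: power_add power_mult) simp
  thus ?thesis by (simp add: qpoch_def)
qed

lemma qpoch_inf_denominator_nonzero:
  assumes "norm q < 1"
  shows "qpoch_inf (q ^ 2) (q ^ 2) \<noteq> 0"
proof -
  have "norm (q ^ 2) < 1"
    using assms by (simp add: norm_power power_less_one_iff)
  moreover have "1 - q ^ 2 * (q ^ 2) ^ i \<noteq> 0" for i
    using power_neq_one(1)[OF assms, of "2 + 2 * i"] by (simp only: power_add power_mult) simp
  ultimately show ?thesis
    unfolding qpoch_inf_def by (intro prodinf_nonzero convergent_qpoch_inf) auto
qed

lemma summable_over_qint:
  assumes "norm q < 1" "strict_mono f" "f 0 > 0"
  shows "summable (\<lambda>j. q ^ f j / qint q (f j) ^ 2)"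
proof (rule summable_comparison_test)
  define c where "c = (2 / (1 - norm q)) ^ 2"
  have pos: "f j > 0" for j
    using strict_mono_leD[OF assms(2), of 0 j] assms(3) by simp
  have le: "j \<le> f j" for j
    using assms(2) by (rule strict_mono_imp_increasing)
  have "norm (q ^ f j / qint q (f j) ^ 2) \<le> norm q ^ j * c" for j
  proof -
    have "norm q ^ f j \<le> norm q ^ 1"
      using assms(1) pos[of j] by (intro power_decreasing) auto
    hence "1 - norm q \<le> norm (1 - q ^ f j)"
      using norm_triangle_ineq2[of 1 "q ^ f j"] by (simp add: norm_power)
    moreover have "norm (1 - q) \<le> 2"
      using norm_triangle_ineq4[of 1 q] assms(1) by simp
    ultimately have "norm ((1 - q) / (1 - q ^ f j)) \<le> 2 / (1 - norm q)"
      unfolding norm_divide using assms(1) by (intro frac_le) auto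
    hence "norm ((1 - q) / (1 - q ^ f j)) ^ 2 \<le> c"
      unfolding c_def by (intro power_mono) auto
    moreover have "norm q ^ f j \<le> norm q ^ j"
      using assms(1) le[of j] by (intro power_decreasing) auto
    ultimately have "norm q ^ f j * norm ((1 - q) / (1 - q ^ f j)) ^ 2 \<le> norm q ^ j * c"
      by (intro mult_mono) auto
    thus ?thesis
      using assms(1) by (simp add: qint_conv norm_mult norm_divide norm_power power_divide)
  qed
  thus "\<exists>N. \<forall>j\<ge>N. norm (q ^ f j / qint q (f j) ^ 2) \<le> norm q ^ j * c" by blast
  show "summable (\<lambda>j. norm q ^ j * c)"
    using assms(1) by (intro summable_mult2 summable_geometric) auto
qed

lemma summable_qint_even:
  assumes "norm q < 1"
  shows "summable (\<lambda>j. q ^ (2 * Suc j) / qint q (2 * Suc j) ^ 2)"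
  using summable_over_qint[OF assms, of "\<lambda>j. 2 * Suc j"] by (simp add: strict_mono_def)

lemma summable_qint_odd:
  assumes "norm q < 1"
  shows "summable (\<lambda>j. q ^ (2 * Suc j - 1) / qint q (2 * Suc j - 1) ^ 2)"
  using summable_over_qint[OF assms, of "\<lambda>j. 2 * Suc j - 1"] by (simp add: strict_mono_def)

end

theory Submission
  imports Defs "HOL-Complex_Analysis.Cauchy_Integral_Formula"
begin

text \<open>
  The identity is the derivative, at a degenerate point, of two one-parameter summations. With base
  \<open>p = q\<^sup>2\<close>, both come from an accelerated form of the limiting case
  \<open>(a, ap/(bc); p)\<^sub>\<infinity> / (ap/b, ap/c; p)\<^sub>\<infinity>\<close> of the very-well-poised \<open>\<^sub>6\<phi>\<^sub>5\<close> sum. The accelerated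
  series and this product satisfy the same first-order recurrence under \<open>a \<mapsto> ap\<close> (for the series,
  by telescoping), and both tend to 1 as \<open>a\<close> tends to 0.

  The choices \<open>(a, b, c) = (q, qt, q/t)\<close> and \<open>a = b = c = qt\<close> give series symmetric under
  \<open>t \<mapsto> 1/t\<close>, hence functions of \<open>u = t + 1/t - 2\<close>. Since
  \<open>(1 - yt)(1 - y/t) = (1 - y)\<^sup>2 - yu\<close>, differentiating at \<open>u = 0\<close> produces the sums over even,
  respectively odd, \<open>q\<close>-integers; the theorem is the first result minus \<open>3(1+q)\<^sup>3/64\<close> times the second.
\<close>

section \<open>The accelerated series and its contiguity relation\<close>

definition dougall_weight :: "complex \<Rightarrow> complex \<Rightarrow> complex \<Rightarrow> complex \<Rightarrow> nat \<Rightarrow> complex" where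
  "dougall_weight a b c p n =
     p ^ (3 * n ^ 2) * (a ^ 2 / (b * c)) ^ n
     * (qpoch (a * p / (b * c)) p n * qpoch (p / b) p n * qpoch (p / c) p n
        * qpoch a p n * qpoch b p n * qpoch c p n)
     / (qpoch (a * p / b) p (2 * n) * qpoch (a * p / c) p (2 * n) * qpoch p p (2 * n))"

text \<open>At x = 1 this is the ratio of the closed product at a to the closed product at ap. At x
  = p^n it is what that ratio becomes when multiplied by the quotient of the n-th weights at ap and
  a; see \<open>dougall_weight_shift\<close>.\<close>

definition shift_ratio :: "complex \<Rightarrow> complex \<Rightarrow> complex \<Rightarrow> complex \<Rightarrow> complex \<Rightarrow> complex" where
  "shift_ratio a b c p x =
     x ^ 2 * (1 - a * x) * (1 - a * p / (b * c) * x)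
     / ((1 - a * p / b * x ^ 2) * (1 - a * p / c * x ^ 2))"

text \<open>The rational part of the n-th summand, built so that the contiguity relation telescopes
  with the simple certificate 1 - x^2. At a = 0 it equals 1, which normalises the limit of the
  series.\<close>

definition dougall_factor :: "complex \<Rightarrow> complex \<Rightarrow> complex \<Rightarrow> complex \<Rightarrow> complex \<Rightarrow> complex" where
  "dougall_factor a b c p x =
     (1 - x ^ 2) + shift_ratio a b c p x
       * (1 - a * p / b * x ^ 2
          + a * p / b * x ^ 2 * (1 - p / c * x) * (1 - b * x) / (1 - p * x ^ 2))"

definition step_ratio :: "complex \<Rightarrow> complex \<Rightarrow> complex \<Rightarrow> complex \<Rightarrow> complex \<Rightarrow> complex" where
  "step_ratio a b c p x =
     p ^ 3 * x ^ 6 * (a ^ 2 / (b * c))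
     * ((1 - a * p / (b * c) * x) * (1 - p / b * x) * (1 - p / c * x)
        * (1 - a * x) * (1 - b * x) * (1 - c * x))
     / ((1 - a * p / b * x ^ 2) * (1 - a * p / b * (p * x ^ 2))
        * ((1 - a * p / c * x ^ 2) * (1 - a * p / c * (p * x ^ 2)))
        * ((1 - p * x ^ 2) * (1 - p * (p * x ^ 2))))"

text \<open>
  Here \<open>x\<close> stands for \<open>p\<^sup>n\<close>: the step ratio moves \<open>n\<close> to \<open>n + 1\<close>, the shift ratio moves \<open>a\<close> to \<open>ap\<close>.
\<close>

lemma factor_contiguity:
  fixes a b c p x :: complex
  assumes "b \<noteq> 0" "c \<noteq> 0"
    and "1 - a * p / b * x ^ 2 \<noteq> 0" "1 - a * p / b * (p * x ^ 2) \<noteq> 0"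
    and "1 - a * p / c * x ^ 2 \<noteq> 0" "1 - a * p / c * (p * x ^ 2) \<noteq> 0"
    and "1 - p * x ^ 2 \<noteq> 0" "1 - p * (p * x ^ 2) \<noteq> 0"
  shows "dougall_factor a b c p x - shift_ratio a b c p x * dougall_factor (a * p) b c p x
       = (1 - x ^ 2) - step_ratio a b c p x * (1 - (p * x) ^ 2)"
proof -
  \<comment> \<open>With s and r in place of 1/b and 1/c everything except the d's is polynomial,
    and \<open>algebra\<close> only has to work modulo b s = 1 and c r = 1.\<close>
  define s r where "s = 1 / b" and "r = 1 / c"
  have sr: "b * s = 1" "c * r = 1"
    using assms(1,2) by (simp_all add: s_def r_def)
  define d1 d2 d3 d4 d5 where "d1 = 1 - a * p * s * x ^ 2" and "d2 = 1 - a * p * s * p * x ^ 2"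
    and "d3 = 1 - a * p * r * x ^ 2" and "d4 = 1 - a * p * r * p * x ^ 2" and "d5 = 1 - p * x ^ 2"
  define d6 where "d6 = 1 - p * (p * x ^ 2)"
  note ds = d1_def d2_def d3_def d4_def d5_def
  have nz: "d1 \<noteq> 0" "d2 \<noteq> 0" "d3 \<noteq> 0" "d4 \<noteq> 0" "d5 \<noteq> 0" "d6 \<noteq> 0"
    using assms(3-) by (simp_all add: ds d6_def s_def r_def mult_ac)
  define N where "N = (1 - a * x) * (1 - a * p * s * r * x)"
  define N' where "N' = (1 - a * p * x) * (1 - a * p * s * r * p * x)"
  have sh: "shift_ratio a b c p x = x ^ 2 * N / (d1 * d3)"
    unfolding shift_ratio_def N_def ds s_def r_def by (simp add: mult_ac)
  have sh': "shift_ratio (a * p) b c p x = x ^ 2 * N' / (d2 * d4)"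
    unfolding shift_ratio_def N'_def ds s_def r_def by (simp add: mult_ac)
  have f1: "dougall_factor a b c p x = (1 - x ^ 2) + x ^ 2 * N / (d1 * d3) *
       (d1 + a * p * s * x ^ 2 * (1 - p * r * x) * (1 - b * x) / d5)"
    unfolding dougall_factor_def sh by (simp add: ds s_def r_def mult_ac)
  have f2: "dougall_factor (a * p) b c p x = (1 - x ^ 2) + x ^ 2 * N' / (d2 * d4) *
       (d2 + a * p * s * p * x ^ 2 * (1 - p * r * x) * (1 - b * x) / d5)"
    unfolding dougall_factor_def sh' by (simp add: ds s_def r_def mult_ac)
  have st: "step_ratio a b c p x = x ^ 2 * N / (d1 * d3) * (a ^ 2 * p ^ 3 * s * r * x ^ 4 *
       ((1 - p * s * x) * (1 - p * r * x) * (1 - b * x) * (1 - c * x)) / (d2 * d4 * d5 * d6))"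
    unfolding step_ratio_def N_def ds d6_def s_def r_def
    by (simp add: mult_ac power2_eq_square power_numeral_reduce)
  have d6: "1 - (p * x) ^ 2 = d6" by (simp add: d6_def power2_eq_square mult_ac)
  \<comment> \<open>Apart from 1 - x^2, every term of the claim contains
    \<open>shift_ratio a b c p x\<close>, the step ratio included. This is the identity between the
    cofactors; the factor d6 of the step ratio's denominator has cancelled against 1 - (p
    x)^2.\<close>
  have key: "(d1 + a * p * s * x ^ 2 * (1 - p * r * x) * (1 - b * x) / d5)
     - ((1 - x ^ 2) + x ^ 2 * N' / (d2 * d4) *
       (d2 + a * p * s * p * x ^ 2 * (1 - p * r * x) * (1 - b * x) / d5))
     = - (a ^ 2 * p ^ 3 * s * r * x ^ 4 *
       ((1 - p * s * x) * (1 - p * r * x) * (1 - b * x) * (1 - c * x)) / (d2 * d4 * d5))"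
  proof -
    have "(d1 * d5 + a * p * s * x ^ 2 * (1 - p * r * x) * (1 - b * x)) * d2 * d4
     - ((1 - x ^ 2) * d5 * d2 * d4 + x ^ 2 * N' *
       (d2 * d5 + a * p * s * p * x ^ 2 * (1 - p * r * x) * (1 - b * x)))
     = - (a ^ 2 * p ^ 3 * s * r * x ^ 4 *
       ((1 - p * s * x) * (1 - p * r * x) * (1 - b * x) * (1 - c * x)))"
      unfolding ds N'_def using sr by algebra
    with nz show ?thesis by (simp add: divide_simps) (simp add: algebra_simps)
  qed
  have "dougall_factor a b c p x - shift_ratio a b c p x * dougall_factor (a * p) b c p x
     - (1 - x ^ 2) = x ^ 2 * N / (d1 * d3) * ((d1 + a * p * s * x ^ 2 * (1 - p * r * x) * (1 - b * x) / d5)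
     - ((1 - x ^ 2) + x ^ 2 * N' / (d2 * d4) *
       (d2 + a * p * s * p * x ^ 2 * (1 - p * r * x) * (1 - b * x) / d5)))"
    unfolding f1 f2 sh by (simp add: algebra_simps)
  also have "\<dots> = - (step_ratio a b c p x * d6)"
  proof -
    have "step_ratio a b c p x * d6 = x ^ 2 * N / (d1 * d3) * (a ^ 2 * p ^ 3 * s * r * x ^ 4 *
        ((1 - p * s * x) * (1 - p * r * x) * (1 - b * x) * (1 - c * x)) / (d2 * d4 * d5))"
      unfolding st using nz(6) by (simp add: mult_ac)
    thus ?thesis unfolding key by (simp only: mult_minus_right)
  qed
  finally show ?thesis unfolding d6 by (metis (no_types) add_uminus_conv_diff diff_eq_eq add.commute)
qed

section \<open>The weights under n -> n + 1 and a -> ap\<close>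

lemma qpoch_0 [simp]: "qpoch x p 0 = 1"
  by (simp add: qpoch_def)

lemma qpoch_Suc: "qpoch x p (Suc n) = qpoch x p n * (1 - x * p ^ n)"
  by (simp add: qpoch_def mult.commute)

text \<open>Both sides are (x;p)_{n+1}, with the first or the last factor split off.\<close>

lemma qpoch_shift: "(1 - x) * qpoch (x * p) p n = qpoch x p n * (1 - x * p ^ n)"
proof -
  have "qpoch x p (Suc n) = (1 - x) * qpoch (x * p) p n"
    unfolding qpoch_def prod.lessThan_Suc_shift by (simp add: mult_ac)
  thus ?thesis by (simp add: qpoch_Suc)
qed

lemma dougall_weight_0 [simp]: "dougall_weight a b c p 0 = 1"
  by (simp add: dougall_weight_def)

lemma dougall_weight_Suc:
  "dougall_weight a b c p (Suc n) = dougall_weight a b c p n * step_ratio a b c p (p ^ n)"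
proof -
  \<comment> \<open>The increment 3(n+1)^2 - 3n^2 = 6n + 3 is the source of p^3 x^6 in
    \<open>step_ratio\<close>.\<close>
  have p: "p ^ (3 * (Suc n) ^ 2) = p ^ (3 * n ^ 2) * (p ^ 3 * (p ^ n) ^ 6)"
  proof -
    have "3 * (Suc n) ^ 2 = 3 * n ^ 2 + (3 + n * 6)"
      by (simp add: power2_eq_square)
    thus ?thesis by (simp add: power_add power_mult)
  qed
  have sq: "(p ^ n) ^ 2 = p ^ (2 * n)"
    by (metis power_mult mult.commute)
  have two: "qpoch y p (2 * Suc n) = qpoch y p (2 * n) * ((1 - y * (p ^ n) ^ 2) * (1 - y * (p * (p ^ n) ^ 2)))" for y
    unfolding sq by (simp add: qpoch_Suc mult_ac)
  define W where "W = a ^ 2 / (b * c)"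
  show ?thesis
    unfolding dougall_weight_def step_ratio_def p two W_def [symmetric] qpoch_Suc power_Suc
      times_divide_times_eq
    by (simp only: mult_ac)
qed

text \<open>Four of the symbols depend on a, and \<open>shift_ratio\<close> at 1 carries exactly the
  four factors that \<open>qpoch_shift\<close> needs to move each of them from a to ap. The factor
  x^2 comes from (a^2/(bc))^n.\<close>

lemma dougall_weight_shift:
  assumes "1 - a * p / b \<noteq> 0" "1 - a * p / b * (p ^ n) ^ 2 \<noteq> 0"
    and "1 - a * p / c \<noteq> 0" "1 - a * p / c * (p ^ n) ^ 2 \<noteq> 0"
  shows "shift_ratio a b c p 1 * dougall_weight (a * p) b c p n
       = shift_ratio a b c p (p ^ n) * dougall_weight a b c p n"
proof -
  have den: "inverse (1 - y) * inverse (qpoch (y * p) p (2 * n)) =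
      inverse (qpoch y p (2 * n)) * inverse (1 - y * (p ^ n) ^ 2)" for y
    using arg_cong[OF qpoch_shift[of y p "2 * n"], of inverse]
    by (simp add: power_mult [symmetric] mult.commute[of n 2])
  have p: "((a * p) ^ 2 / (b * c)) ^ n = (a ^ 2 / (b * c)) ^ n * (p ^ n) ^ 2"
    by (simp add: power_mult_distrib power_divide power_mult [symmetric] mult.commute[of n 2])
  define B C D where "B = a * p / b" and "C = a * p / c" and "D = a * p / (b * c)"
  have e: "a * p * p / b = B * p" "a * p * p / c = C * p" "a * p * p / (b * c) = D * p"
    by (simp_all add: B_def C_def D_def)
  define R where "R = p ^ (3 * n ^ 2) * (a ^ 2 / (b * c)) ^ n * (p ^ n) ^ 2 *
     (qpoch (p / b) p n * qpoch (p / c) p n * qpoch b p n * qpoch c p n) * inverse (qpoch p p (2 * n))"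
  have "shift_ratio a b c p 1 * dougall_weight (a * p) b c p n = R *
     (((1 - a) * qpoch (a * p) p n) * ((1 - D) * qpoch (D * p) p n)) *
     (inverse (1 - B) * inverse (qpoch (B * p) p (2 * n))) *
     (inverse (1 - C) * inverse (qpoch (C * p) p (2 * n)))"
    unfolding dougall_weight_def shift_ratio_def p e B_def[symmetric] C_def[symmetric]
      D_def[symmetric] R_def
    by (simp add: divide_inverse mult_ac)
  also have "\<dots> = shift_ratio a b c p (p ^ n) * dougall_weight a b c p n"
    unfolding den qpoch_shift
    unfolding dougall_weight_def shift_ratio_def p e B_def[symmetric] C_def[symmetric]
      D_def[symmetric] R_def
    by (simp add: divide_inverse)
  finally show ?thesis .
qed

section \<open>Uniform bounds and a summable majorant\<close>

lemma norm_qpoch_le: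
  assumes "norm x \<le> K" "norm p \<le> \<rho>" "\<rho> < 1"
  shows "norm (qpoch x p n) \<le> exp (K / (1 - \<rho>))"
proof -
  have \<rho>: "0 \<le> \<rho>" and K: "0 \<le> K"
    using assms norm_ge_zero order_trans by blast+
  have "norm (qpoch x p n) \<le> (\<Prod>i<n. 1 + K * \<rho> ^ i)"
    unfolding qpoch_def prod_norm [symmetric]
  proof (intro prod_mono conjI)
    fix i
    have "norm (x * p ^ i) \<le> K * \<rho> ^ i"
      unfolding norm_mult norm_power using assms K by (intro mult_mono power_mono) auto
    thus "norm (1 - x * p ^ i) \<le> 1 + K * \<rho> ^ i"
      using norm_triangle_ineq4[of 1 "x * p ^ i"] by simp
  qed auto
  \<comment> \<open>Here 1 + y \<le> exp y is used; completing the geometric series in the exponent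
    then removes the dependence on n.\<close>
  also have "\<dots> \<le> exp (\<Sum>i<n. K * \<rho> ^ i)"
    using \<rho> K by (intro prod_le_exp_sum) auto
  also have "(\<Sum>i<n. K * \<rho> ^ i) \<le> K / (1 - \<rho>)"
  proof -
    have "(\<Sum>i<n. \<rho> ^ i) \<le> (\<Sum>i. \<rho> ^ i)"
      using \<rho> assms by (intro sum_le_suminf summable_geometric) auto
    also have "\<dots> = 1 / (1 - \<rho>)"
      using \<rho> assms by (intro suminf_geometric) auto
    finally show ?thesis
      using K by (simp add: sum_distrib_left [symmetric] divide_inverse mult_left_mono)
  qed
  finally show ?thesis by simp
qed

text \<open>For 0 \<le> s \<le> \<rho> < 1 one has 1 - s \<ge> exp (-s/(1 - \<rho>)), from 1 + y
  \<le> exp y at y = s/(1 - s). With s = \<rho>^(i+1) the exponents sum to at most \<rho>/(1 -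
  \<rho>)^2, independently of n.\<close>

lemma norm_qpoch_ge:
  assumes "norm x \<le> \<rho>" "norm p \<le> \<rho>" "\<rho> < 1"
  shows "exp (- \<rho> / (1 - \<rho>) ^ 2) \<le> norm (qpoch x p n)"
proof -
  have \<rho>: "0 \<le> \<rho>"
    using assms norm_ge_zero order_trans by blast
  have s: "exp (- (\<rho> / (1 - \<rho>)) * \<rho> ^ i) \<le> norm (1 - x * p ^ i)" for i
  proof -
    define s where "s = \<rho> * \<rho> ^ i"
    have "norm (x * p ^ i) \<le> s"
      unfolding norm_mult norm_power s_def using assms \<rho> by (intro mult_mono power_mono) auto
    hence 1: "1 - s \<le> norm (1 - x * p ^ i)"
      using norm_triangle_ineq2[of 1 "x * p ^ i"] by simp
    have sr: "0 \<le> s" "s \<le> \<rho>"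
      using \<rho> assms(3) by (auto simp: s_def mult_left_le power_le_one)
    have "1 + s / (1 - s) \<le> exp (s / (1 - s))"
      by (rule exp_ge_add_one_self)
    also have "s / (1 - s) \<le> s / (1 - \<rho>)"
      using sr assms(3) by (intro divide_left_mono) auto
    finally have "inverse (1 - s) \<le> exp (s / (1 - \<rho>))"
      using sr assms(3) by (simp add: field_simps)
    hence "inverse (exp (s / (1 - \<rho>))) \<le> inverse (inverse (1 - s))"
      using sr assms(3) by (intro le_imp_inverse_le) auto
    hence "exp (- (s / (1 - \<rho>))) \<le> 1 - s"
      by (simp add: exp_minus)
    with 1 show ?thesis by (simp add: s_def)
  qed
  have "(\<Sum>i<n. \<rho> ^ i) \<le> (\<Sum>i. \<rho> ^ i)"
    using \<rho> assms by (intro sum_le_suminf summable_geometric) auto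
  also have "\<dots> = 1 / (1 - \<rho>)"
    using \<rho> assms by (intro suminf_geometric) auto
  finally have "\<rho> / (1 - \<rho>) * (\<Sum>i<n. \<rho> ^ i) \<le> \<rho> / (1 - \<rho>) * (1 / (1 - \<rho>))"
    using \<rho> assms(3) by (intro mult_left_mono) auto
  hence "exp (- \<rho> / (1 - \<rho>) ^ 2) \<le> exp (\<Sum>i<n. - (\<rho> / (1 - \<rho>)) * \<rho> ^ i)"
    by (simp add: sum_negf power2_eq_square flip: sum_distrib_left sum_divide_distrib)
  also have "\<dots> = (\<Prod>i<n. exp (- (\<rho> / (1 - \<rho>)) * \<rho> ^ i))"
    by (rule exp_sum) simp
  also have "\<dots> \<le> norm (qpoch x p n)"
    unfolding qpoch_def prod_norm [symmetric] using s by (intro prod_mono) auto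
  finally show ?thesis .
qed

text \<open>Consecutive terms have ratio \<rho>^(6n+3) K, which tends to 0 however large K is. This
  is why \<open>admissible\<close> asks for smallness only of p and of the parameters in the
  denominators.\<close>

lemma summable_quadratic_power:
  fixes \<rho> K :: real
  assumes "0 \<le> \<rho>" "\<rho> < 1" "0 \<le> K"
  shows "summable (\<lambda>n. \<rho> ^ (3 * n ^ 2) * K ^ n)"
proof -
  have "(\<lambda>n. (\<rho> ^ 6) ^ n * (\<rho> ^ 3 * K)) \<longlonglongrightarrow> 0 * (\<rho> ^ 3 * K)"
    using assms by (intro tendsto_intros LIMSEQ_power_zero) (auto simp: power_less_one_iff)
  hence "\<forall>\<^sub>F n in sequentially. (\<rho> ^ 6) ^ n * (\<rho> ^ 3 * K) < 1 / 2"
    by (rule order_tendstoD) simp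
  then obtain N where N: "\<And>n. n \<ge> N \<Longrightarrow> (\<rho> ^ 6) ^ n * (\<rho> ^ 3 * K) < 1 / 2"
    by (auto simp: eventually_sequentially)
  show ?thesis
  proof (rule summable_ratio_test[of "1 / 2" N])
    fix n assume "n \<ge> N"
    have "norm (\<rho> ^ (3 * (Suc n) ^ 2) * K ^ Suc n) =
        ((\<rho> ^ 6) ^ n * (\<rho> ^ 3 * K)) * (\<rho> ^ (3 * n ^ 2) * K ^ n)"
      using assms by (simp add: norm_mult norm_power power2_eq_square algebra_simps power_add power_mult [symmetric])
    also have "\<dots> \<le> 1 / 2 * (\<rho> ^ (3 * n ^ 2) * K ^ n)"
      using N[OF \<open>n \<ge> N\<close>] assms by (intro mult_right_mono) auto
    finally show "norm (\<rho> ^ (3 * (Suc n) ^ 2) * K ^ Suc n) \<le> 1 / 2 * norm (\<rho> ^ (3 * n ^ 2) * K ^ n)"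
      using assms by simp
  qed simp
qed

text \<open>
  A parameter region on which one summable majorant works; it is needed uniformly both along
  \<open>a p\<^sup>m\<close> and in the deformation parameter \<open>t\<close>.
\<close>

definition admissible :: "real \<Rightarrow> real \<Rightarrow> complex \<Rightarrow> complex \<Rightarrow> complex \<Rightarrow> complex \<Rightarrow> bool" where
  "admissible \<rho> K a b c p \<longleftrightarrow> b \<noteq> 0 \<and> c \<noteq> 0 \<and> norm p \<le> \<rho>
     \<and> norm (a * p / b) \<le> \<rho> \<and> norm (a * p / c) \<le> \<rho>
     \<and> norm (a * p / (b * c)) \<le> K \<and> norm (p / b) \<le> K \<and> norm (p / c) \<le> K
     \<and> norm a \<le> K \<and> norm b \<le> K \<and> norm c \<le> K \<and> norm (a ^ 2 / (b * c)) \<le> K"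

lemma norm_one_minus_le:
  fixes y z :: complex
  assumes "norm y \<le> K" "norm z \<le> 1"
  shows "norm (1 - y * z) \<le> 1 + K"
proof -
  have "norm (y * z) \<le> K * 1"
    unfolding norm_mult using assms by (intro mult_mono) (auto intro: order_trans[OF norm_ge_zero])
  thus ?thesis using norm_triangle_ineq4[of 1 "y * z"] by simp
qed

lemma norm_one_minus_ge:
  fixes y z :: complex
  assumes "norm y \<le> \<rho>" "norm z \<le> 1"
  shows "1 - \<rho> \<le> norm (1 - y * z)"
proof -
  have "norm (y * z) \<le> \<rho> * 1"
    unfolding norm_mult using assms by (intro mult_mono) (auto intro: order_trans[OF norm_ge_zero])
  thus ?thesis using norm_triangle_ineq2[of 1 "y * z"] by simp
qed

lemma norm_shift_ratio_le:
  assumes adm: "admissible \<rho> K a b c p" and \<rho>: "\<rho> < 1" and x: "norm x \<le> 1"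
  shows "norm (shift_ratio a b c p x) \<le> (1 + K) ^ 2 / (1 - \<rho>) ^ 2"
proof -
  have x2: "norm (x ^ 2) \<le> 1"
    using x by (simp add: norm_power power_le_one)
  have K: "0 \<le> K" using adm by (auto simp: admissible_def intro: order_trans[OF norm_ge_zero])
  have "norm (x ^ 2) * norm (1 - a * x) * norm (1 - a * p / (b * c) * x) \<le> 1 * (1 + K) * (1 + K)"
    using adm x x2 K unfolding admissible_def
    by (intro mult_mono norm_one_minus_le) auto
  moreover have "(1 - \<rho>) * (1 - \<rho>) \<le> norm (1 - a * p / b * x ^ 2) * norm (1 - a * p / c * x ^ 2)"
    using adm x2 \<rho> unfolding admissible_def by (intro mult_mono norm_one_minus_ge) auto
  ultimately show ?thesis
    unfolding shift_ratio_def norm_divide norm_mult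
    using \<rho> K by (intro frac_le) (auto simp: power2_eq_square)
qed

lemma norm_dougall_factor_le:
  assumes adm: "admissible \<rho> K a b c p" and \<rho>: "\<rho> < 1" and x: "norm x \<le> 1"
  shows "norm (dougall_factor a b c p x)
       \<le> 2 + (1 + K) ^ 2 / (1 - \<rho>) ^ 2 * (2 + (1 + K) ^ 2 / (1 - \<rho>))"
proof -
  have x2: "norm (x ^ 2) \<le> 1"
    using x by (simp add: norm_power power_le_one)
  have K: "0 \<le> K" using adm by (auto simp: admissible_def intro: order_trans[OF norm_ge_zero])
  have be: "norm (a * p / b) \<le> 1"
    using adm \<rho> by (auto simp: admissible_def)
  have "norm (a * p / b) * norm (x ^ 2) * norm (1 - p / c * x) * norm (1 - b * x)
      \<le> 1 * 1 * (1 + K) * (1 + K)"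
    using adm x x2 K be unfolding admissible_def
    by (intro mult_mono norm_one_minus_le) auto
  moreover have "1 - \<rho> \<le> norm (1 - p * x ^ 2)"
    using adm x2 \<rho> unfolding admissible_def by (intro norm_one_minus_ge) auto
  ultimately have 1: "norm (a * p / b * x ^ 2 * (1 - p / c * x) * (1 - b * x) / (1 - p * x ^ 2))
      \<le> (1 + K) ^ 2 / (1 - \<rho>)"
    unfolding norm_divide[of _ "1 - p * x ^ 2"] norm_mult[of _ "1 - b * x"] norm_mult[of _ "1 - p / c * x"]
      norm_mult[of _ "x ^ 2"]
    using \<rho> K by (intro frac_le) (auto simp: power2_eq_square)
  have 2: "norm (1 - a * p / b * x ^ 2) \<le> 1 + 1"
    using be x2 by (rule norm_one_minus_le)
  have 3: "norm (1 - x ^ 2) \<le> 1 + 1"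
    using norm_one_minus_le[of 1 1 "x ^ 2"] x2 by simp
  have "norm (shift_ratio a b c p x * (1 - a * p / b * x ^ 2
          + a * p / b * x ^ 2 * (1 - p / c * x) * (1 - b * x) / (1 - p * x ^ 2)))
      \<le> (1 + K) ^ 2 / (1 - \<rho>) ^ 2 * (2 + (1 + K) ^ 2 / (1 - \<rho>))"
    unfolding norm_mult[of "shift_ratio a b c p x"] using norm_triangle_mono[OF 2 1] K \<rho>
    by (intro mult_mono norm_shift_ratio_le adm \<rho> x) auto
  from norm_triangle_mono[OF 3 this] show ?thesis
    unfolding dougall_factor_def by simp
qed

text \<open>The exponents 6 and 3 count the symbols in the numerator and in the denominator of the
  weight.\<close>

lemma norm_dougall_weight_le:
  assumes adm: "admissible \<rho> K a b c p" and \<rho>: "\<rho> < 1"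
  shows "norm (dougall_weight a b c p n)
       \<le> exp (K / (1 - \<rho>)) ^ 6 / exp (- \<rho> / (1 - \<rho>) ^ 2) ^ 3 * (\<rho> ^ (3 * n ^ 2) * K ^ n)"
proof -
  define C where "C = exp (K / (1 - \<rho>))"
  define e where "e = exp (- \<rho> / (1 - \<rho>) ^ 2)"
  have K: "0 \<le> K" and \<rho>0: "0 \<le> \<rho>"
    using adm by (auto simp: admissible_def intro: order_trans[OF norm_ge_zero])
  have C: "0 \<le> C" and e: "0 < e" by (auto simp: C_def e_def)
  have up: "norm (qpoch y p n) \<le> C" if "norm y \<le> K" for y
    unfolding C_def using that adm \<rho> by (intro norm_qpoch_le) (auto simp: admissible_def)
  have lo: "e \<le> norm (qpoch y p (2 * n))" if "norm y \<le> \<rho>" for y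
    unfolding e_def using that adm \<rho> by (intro norm_qpoch_ge) (auto simp: admissible_def)
  have "norm (p ^ (3 * n ^ 2)) * norm ((a ^ 2 / (b * c)) ^ n) \<le> \<rho> ^ (3 * n ^ 2) * K ^ n"
    unfolding norm_power using adm K \<rho>0 unfolding admissible_def by (intro mult_mono power_mono) auto
  moreover have "norm (qpoch (a * p / (b * c)) p n) * norm (qpoch (p / b) p n) * norm (qpoch (p / c) p n)
        * norm (qpoch a p n) * norm (qpoch b p n) * norm (qpoch c p n) \<le> C * C * C * C * C * C"
    using adm C unfolding admissible_def by (intro mult_mono up mult_nonneg_nonneg) auto
  ultimately have "norm (p ^ (3 * n ^ 2)) * norm ((a ^ 2 / (b * c)) ^ n) *
      (norm (qpoch (a * p / (b * c)) p n) * norm (qpoch (p / b) p n) * norm (qpoch (p / c) p n)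
        * norm (qpoch a p n) * norm (qpoch b p n) * norm (qpoch c p n))
      \<le> (\<rho> ^ (3 * n ^ 2) * K ^ n) * (C * C * C * C * C * C)"
    by (rule mult_mono) (use K \<rho>0 in auto)
  moreover have "e * e * e \<le> norm (qpoch (a * p / b) p (2 * n)) * norm (qpoch (a * p / c) p (2 * n))
      * norm (qpoch p p (2 * n))"
    using adm e unfolding admissible_def by (intro mult_mono lo mult_nonneg_nonneg) auto
  ultimately have "norm (dougall_weight a b c p n) \<le>
      (\<rho> ^ (3 * n ^ 2) * K ^ n) * (C * C * C * C * C * C) / (e * e * e)"
    unfolding dougall_weight_def norm_divide[of _ "_ * qpoch p p (2 * n)"]
      norm_mult[of _ "qpoch _ _ _"] norm_mult[of _ "_ ^ n"] norm_mult[of _ "_ * qpoch _ _ _"]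
    using K \<rho>0 e C by (intro frac_le) auto
  thus ?thesis
    unfolding C_def [symmetric] e_def [symmetric]
    by (simp add: power_numeral_reduce mult_ac)
qed

lemma dougall_majorant:
  assumes "0 \<le> \<rho>" "\<rho> < 1" "0 \<le> K"
  obtains M :: "nat \<Rightarrow> real" where "summable M"
    and "\<And>a b c p n. admissible \<rho> K a b c p \<Longrightarrow> norm (dougall_weight a b c p n) \<le> M n"
    and "\<And>a b c p n. admissible \<rho> K a b c p \<Longrightarrow>
           norm (dougall_weight a b c p n * dougall_factor a b c p (p ^ n)) \<le> M n"
proof -
  define W where "W = (\<lambda>n. exp (K / (1 - \<rho>)) ^ 6 / exp (- \<rho> / (1 - \<rho>) ^ 2) ^ 3 * (\<rho> ^ (3 * n ^ 2) * K ^ n))"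
  \<comment> \<open>The bound of \<open>norm_dougall_factor_le\<close>. As it is at least 1, the
    single sequence W n * A dominates both the bare weight and the full summand.\<close>
  define A where "A = 2 + (1 + K) ^ 2 / (1 - \<rho>) ^ 2 * (2 + (1 + K) ^ 2 / (1 - \<rho>))"
  have W: "0 \<le> W n" for n
    using assms by (simp add: W_def)
  have "0 \<le> (1 + K) ^ 2 / (1 - \<rho>) ^ 2 * (2 + (1 + K) ^ 2 / (1 - \<rho>))"
    using assms by simp
  hence A: "1 \<le> A" unfolding A_def by linarith
  show ?thesis
  proof (rule that[of "\<lambda>n. W n * A"])
    show "summable (\<lambda>n. W n * A)"
      unfolding W_def using assms by (intro summable_mult summable_mult2 summable_quadratic_power)
    fix a b c p n
    assume adm: "admissible \<rho> K a b c p"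
    have w: "norm (dougall_weight a b c p n) \<le> W n"
      unfolding W_def using adm assms(2) by (rule norm_dougall_weight_le)
    also have "W n * 1 \<le> W n * A"
      using W A by (intro mult_left_mono)
    finally show "norm (dougall_weight a b c p n) \<le> W n * A" by simp
    have "norm p \<le> 1" using adm assms by (auto simp: admissible_def)
    hence "norm (dougall_factor a b c p (p ^ n)) \<le> A"
      unfolding A_def using adm assms(2)
      by (intro norm_dougall_factor_le) (auto simp: norm_power power_le_one)
    thus "norm (dougall_weight a b c p n * dougall_factor a b c p (p ^ n)) \<le> W n * A"
      unfolding norm_mult using w W by (intro mult_mono) auto
  qed
qed

text \<open>Passing from a to a p^m multiplies each quantity in \<open>admissible\<close> by a power
  of p, of norm at most 1, or leaves it unchanged. Hence the maxima taken at m = 0 serve for all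
  m.\<close>

lemma admissible_exists:
  assumes "norm p < 1" "b \<noteq> 0" "c \<noteq> 0" "norm (a * p / b) < 1" "norm (a * p / c) < 1"
  obtains \<rho> K where "0 \<le> \<rho>" "\<rho> < 1" "0 \<le> K" "\<And>m. admissible \<rho> K (a * p ^ m) b c p"
proof -
  define Y where "Y = {p, a * p / b, a * p / c}"
  define Z where "Z = {a * p / (b * c), p / b, p / c, a, b, c, a ^ 2 / (b * c)}"
  define \<rho> where "\<rho> = Max (norm ` Y)"
  define K where "K = Max (norm ` Z)"
  have Y: "norm z \<le> \<rho>" if "z \<in> Y" for z
    using that unfolding \<rho>_def by (intro Max_ge) (auto simp: Y_def)
  have Z: "norm z \<le> K" if "z \<in> Z" for z
    using that unfolding K_def by (intro Max_ge) (auto simp: Z_def)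
  have dec: "norm (z * p ^ m) \<le> norm z" for z m
    using assms(1) by (simp add: norm_mult norm_power mult_left_le power_le_one)
  have Ym: "norm (z * p ^ m) \<le> \<rho>" if "z \<in> Y" for z m
    using dec Y[OF that] by (rule order_trans)
  have Zm: "norm (z * p ^ m) \<le> K" if "z \<in> Z" for z m
    using dec Z[OF that] by (rule order_trans)
  have "admissible \<rho> K (a * p ^ m) b c p" for m
  proof -
    have "a * p ^ m * p / b = a * p / b * p ^ m" "a * p ^ m * p / c = a * p / c * p ^ m"
      "a * p ^ m * p / (b * c) = a * p / (b * c) * p ^ m"
      "(a * p ^ m) ^ 2 / (b * c) = a ^ 2 / (b * c) * p ^ (m * 2)"
      by (simp_all add: power_mult power_mult_distrib mult.assoc)
    thus ?thesis
      unfolding admissible_def using assms(2,3)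
      by (simp only:) (intro conjI Y Z Ym Zm; simp add: Y_def Z_def)
  qed
  moreover have "\<rho> < 1"
    using assms unfolding \<rho>_def by (subst Max_less_iff) (auto simp: Y_def)
  moreover have "0 \<le> \<rho>" "0 \<le> K"
    using order_trans[OF norm_ge_zero Y[of p]] order_trans[OF norm_ge_zero Z[of a]]
    by (simp_all add: Y_def Z_def)
  ultimately show ?thesis using that by blast
qed

section \<open>Summation of the accelerated series\<close>

lemma one_minus_mult_power_neq_0:
  fixes y p :: complex
  assumes "norm y < 1" "norm p < 1"
  shows "1 - y * p ^ n \<noteq> 0"
proof -
  have "norm (y * p ^ n) \<le> norm y"
    using assms by (simp add: norm_mult norm_power mult_left_le power_le_one)
  thus ?thesis using assms by auto
qed

lemma qpoch_inf_neq_0: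
  assumes "norm y < 1" "norm p < 1"
  shows "qpoch_inf y p \<noteq> 0"
  unfolding qpoch_inf_def
  using assms by (intro prodinf_nonzero convergent_qpoch_inf one_minus_mult_power_neq_0)

lemma qpoch_neq_0:
  assumes "norm y < 1" "norm p < 1"
  shows "qpoch y p n \<noteq> 0"
  unfolding qpoch_def using one_minus_mult_power_neq_0[OF assms] by simp

lemma qpoch_LIMSEQ:
  assumes "norm p < 1"
  shows "(\<lambda>n. qpoch y p n) \<longlonglongrightarrow> qpoch_inf y p"
proof -
  have "(\<lambda>n. \<Prod>i\<le>n. 1 - y * p ^ i) \<longlonglongrightarrow> qpoch_inf y p"
    unfolding qpoch_inf_def using assms by (intro convergent_prod_LIMSEQ convergent_qpoch_inf)
  hence "(\<lambda>n. qpoch y p (Suc n)) \<longlonglongrightarrow> qpoch_inf y p"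
    by (simp add: qpoch_def lessThan_Suc_atMost)
  thus ?thesis by (rule LIMSEQ_imp_Suc)
qed

text \<open>By \<open>dougall_weight_shift\<close> the n-th terms of both sides are multiples of the
  same weight, and by \<open>factor_contiguity\<close> their difference is T n - T (n+1), whose sum
  is zero.\<close>

lemma dougall_series_shift:
  assumes p: "norm p < 1" and bc: "b \<noteq> 0" "c \<noteq> 0"
    and ab: "norm (a * p / b) < 1" and ac: "norm (a * p / c) < 1"
  shows "(\<Sum>n. dougall_weight a b c p n * dougall_factor a b c p (p ^ n))
       = shift_ratio a b c p 1 *
         (\<Sum>n. dougall_weight (a * p) b c p n * dougall_factor (a * p) b c p (p ^ n))"
proof -
  let ?t = "\<lambda>a n. dougall_weight a b c p n * dougall_factor a b c p (p ^ n)"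
  \<comment> \<open>T 0 = 0 because of the factor 1 - (p^n)^2, and T tends to 0 because the weights
    do; so both boundary terms of the telescoping sum vanish.\<close>
  define T where "T = (\<lambda>n. dougall_weight a b c p n * (1 - (p ^ n) ^ 2))"
  obtain \<rho> K where adm: "0 \<le> \<rho>" "\<rho> < 1" "0 \<le> K" "\<And>m. admissible \<rho> K (a * p ^ m) b c p"
    using admissible_exists[OF p bc ab ac] by blast
  obtain M where M: "summable M" "\<And>a b c p n. admissible \<rho> K a b c p \<Longrightarrow> norm (dougall_weight a b c p n) \<le> M n"
     "\<And>a b c p n. admissible \<rho> K a b c p \<Longrightarrow>
           norm (dougall_weight a b c p n * dougall_factor a b c p (p ^ n)) \<le> M n"
    using dougall_majorant[OF adm(1-3)] by blast
  have sum: "summable (?t (a * p ^ m))" for m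
    by (rule summable_comparison_test[OF _ M(1)]) (use M(3)[OF adm(4)] in blast)
  note sum0 = sum[of 0, simplified] and sum1 = sum[of 1, simplified]
  have "(\<lambda>n. dougall_weight a b c p n) \<longlonglongrightarrow> 0"
    by (rule Lim_null_comparison[OF _ summable_LIMSEQ_zero[OF M(1)]])
       (use M(2)[OF adm(4)[of 0]] in simp)
  moreover have "(\<lambda>n. (p ^ n) ^ 2) \<longlonglongrightarrow> 0 ^ 2"
    by (intro tendsto_power LIMSEQ_power_zero p)
  ultimately have "T \<longlonglongrightarrow> 0 * (1 - 0 ^ 2)"
    unfolding T_def by (intro tendsto_mult tendsto_diff tendsto_const)
  hence "(\<lambda>n. T n - T (Suc n)) sums (T 0 - 0)"
    by (intro telescope_sums') simp
  hence "(\<lambda>n. T n - T (Suc n)) sums 0"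
    by (simp add: T_def)
  also have "(\<lambda>n. T n - T (Suc n)) = (\<lambda>n. ?t a n - shift_ratio a b c p 1 * ?t (a * p) n)"
  proof
    fix n
    let ?x = "p ^ n"
    have nz: "1 - y * ?x ^ 2 \<noteq> 0" "1 - y * (p * ?x ^ 2) \<noteq> 0" "1 - y \<noteq> 0" if "norm y < 1" for y
      using one_minus_mult_power_neq_0[OF that p, of "2 * n"]
        one_minus_mult_power_neq_0[OF that p, of "Suc (2 * n)"]
        one_minus_mult_power_neq_0[OF that p, of 0]
      by (simp_all add: power_mult mult.commute flip: power_mult)
    have "?t a n - shift_ratio a b c p 1 * ?t (a * p) n
        = ?t a n - (shift_ratio a b c p 1 * dougall_weight (a * p) b c p n) * dougall_factor (a * p) b c p ?x"
      by simp
    also have "\<dots> = dougall_weight a b c p n *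
        (dougall_factor a b c p ?x - shift_ratio a b c p ?x * dougall_factor (a * p) b c p ?x)"
      by (subst dougall_weight_shift) (use nz[OF ab] nz[OF ac] in \<open>simp_all add: algebra_simps\<close>)
    also have "\<dots> = T n - T (Suc n)"
      by (subst factor_contiguity)
         (use nz[OF ab] nz[OF ac] nz[OF p] bc in
           \<open>simp_all add: T_def dougall_weight_Suc right_diff_distrib\<close>)
    finally show "T n - T (Suc n) = ?t a n - shift_ratio a b c p 1 * ?t (a * p) n" ..
  qed
  finally have "(\<lambda>n. ?t a n - shift_ratio a b c p 1 * ?t (a * p) n) sums 0" .
  moreover have "(\<lambda>n. ?t a n - shift_ratio a b c p 1 * ?t (a * p) n) sums
      (suminf (?t a) - shift_ratio a b c p 1 * suminf (?t (a * p)))"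
    by (intro sums_diff sums_mult summable_sums sum0 sum1)
  ultimately show ?thesis
    using sums_unique2 by fastforce
qed

text \<open>Iterating the recurrence m times expresses the series as R m times the series at a p^m.
  As m grows, R m tends to the closed product, and the remaining series tends to 1 by dominated
  convergence.\<close>

theorem dougall_series_sums:
  assumes p: "norm p < 1" and bc: "b \<noteq> 0" "c \<noteq> 0"
    and ab: "norm (a * p / b) < 1" and ac: "norm (a * p / c) < 1"
  shows "(\<lambda>n. dougall_weight a b c p n * dougall_factor a b c p (p ^ n)) sums
         (qpoch_inf a p * qpoch_inf (a * p / (b * c)) p
          / (qpoch_inf (a * p / b) p * qpoch_inf (a * p / c) p))"
proof -
  let ?t = "\<lambda>a n. dougall_weight a b c p n * dougall_factor a b c p (p ^ n)"
  \<comment> \<open>The product of the values at x = 1 of the shift ratios for a, ap, ..., a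
    p^(m-1).\<close>
  define R where "R = (\<lambda>m. qpoch a p m * qpoch (a * p / (b * c)) p m
      / (qpoch (a * p / b) p m * qpoch (a * p / c) p m))"
  obtain \<rho> K where adm: "0 \<le> \<rho>" "\<rho> < 1" "0 \<le> K" "\<And>m. admissible \<rho> K (a * p ^ m) b c p"
    using admissible_exists[OF p bc ab ac] by blast
  obtain M where M: "summable M"
     "\<And>a b c p n. admissible \<rho> K a b c p \<Longrightarrow> norm (dougall_weight a b c p n) \<le> M n"
     "\<And>a b c p n. admissible \<rho> K a b c p \<Longrightarrow>
           norm (dougall_weight a b c p n * dougall_factor a b c p (p ^ n)) \<le> M n"
    using dougall_majorant[OF adm(1-3)] by blast
  have sum: "summable (?t a)"
    by (rule summable_comparison_test[OF _ M(1)]) (use M(3)[OF adm(4)[of 0]] in simp)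
  have iter: "suminf (?t a) = R m * suminf (?t (a * p ^ m))" for m
  proof (induction m)
    case 0
    show ?case by (simp add: R_def)
  next
    case (Suc m)
    have le: "norm (y * p ^ m) < 1" if "norm y < 1" for y
    proof -
      have "norm (y * p ^ m) \<le> norm y"
        using p by (simp add: norm_mult norm_power mult_left_le power_le_one)
      thus ?thesis using that by simp
    qed
    have "norm (a * p ^ m * p / b) < 1" "norm (a * p ^ m * p / c) < 1"
      using le[OF ab] le[OF ac] by (simp_all add: mult_ac)
    from dougall_series_shift[OF p bc this] Suc.IH
    have "suminf (?t a) = R m * shift_ratio (a * p ^ m) b c p 1 * suminf (?t (a * p ^ Suc m))"
      by (simp add: mult_ac)
    also have "R m * shift_ratio (a * p ^ m) b c p 1 = R (Suc m)"
      by (simp add: R_def shift_ratio_def qpoch_Suc mult_ac)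
    finally show ?case .
  qed
  have "(\<lambda>m. suminf (?t (a * p ^ m))) \<longlonglongrightarrow> (\<Sum>k. if k = 0 then 1 else 0)"
  proof -
    \<comment> \<open>By continuity the limit is the term at a = 0, where the power (a^2/(bc))^k
      removes all but k = 0. The majorant valid for all a p^m then allows Tannery's theorem.\<close>
    have lim: "(\<lambda>m. ?t (a * p ^ m) k) \<longlonglongrightarrow> (if k = 0 then 1 else 0)" for k
    proof -
      have nz: "1 - p * (p ^ k) ^ 2 \<noteq> 0"
        using one_minus_mult_power_neq_0[OF p p, of "k * 2"] by (simp add: power_mult)
      have "isCont (\<lambda>a. ?t a k) 0"
        unfolding dougall_weight_def dougall_factor_def shift_ratio_def qpoch_def
        using bc nz qpoch_neq_0[OF p p, of "2 * k"]
        by (intro continuous_intros) (auto simp: qpoch_def)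
      moreover have "(\<lambda>m. a * p ^ m) \<longlonglongrightarrow> a * 0"
        using p by (intro tendsto_intros LIMSEQ_power_zero) auto
      ultimately have "(\<lambda>m. ?t (a * p ^ m) k) \<longlonglongrightarrow> ?t 0 k"
        by (intro isCont_tendsto_compose[of 0 "\<lambda>a. ?t a k"]) auto
      also have "?t 0 k = (if k = 0 then 1 else 0)"
        by (simp add: dougall_weight_def dougall_factor_def shift_ratio_def)
      finally show ?thesis .
    qed
    show ?thesis
      using tannerys_theorem[of "\<lambda>k m. ?t (a * p ^ m) k" "\<lambda>k. if k = 0 then 1 else 0" sequentially M]
        lim M adm(4) by (auto intro!: always_eventually)
  qed
  moreover have "R \<longlonglongrightarrow> qpoch_inf a p * qpoch_inf (a * p / (b * c)) p
          / (qpoch_inf (a * p / b) p * qpoch_inf (a * p / c) p)"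
    unfolding R_def using qpoch_inf_neq_0[OF ab p] qpoch_inf_neq_0[OF ac p]
    by (intro tendsto_intros qpoch_LIMSEQ p) auto
  ultimately have "(\<lambda>m. R m * suminf (?t (a * p ^ m))) \<longlonglongrightarrow>
      qpoch_inf a p * qpoch_inf (a * p / (b * c)) p
          / (qpoch_inf (a * p / b) p * qpoch_inf (a * p / c) p) * (\<Sum>k. if k = 0 then 1 else 0)"
    by (rule tendsto_mult[rotated])
  moreover have "(\<Sum>k. if k = 0 then 1 else 0 :: complex) = 1"
    using suminf_finite[of "{0}" "\<lambda>k. if k = 0 then 1 else 0 :: complex"] by simp
  ultimately have "suminf (?t a) = qpoch_inf a p * qpoch_inf (a * p / (b * c)) p
          / (qpoch_inf (a * p / b) p * qpoch_inf (a * p / c) p)"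
    unfolding iter [symmetric] by (simp add: LIMSEQ_const_iff)
  with sum show ?thesis
    using summable_sums by metis
qed

section \<open>Symmetric products as functions of u, and differentiation at u = 0\<close>

definition sym_qpoch :: "complex \<Rightarrow> complex \<Rightarrow> nat \<Rightarrow> complex \<Rightarrow> complex" where
  "sym_qpoch x p n u = (\<Prod>i<n. (1 - x * p ^ i) ^ 2 - x * p ^ i * u)"

text \<open>A derivative in t itself would vanish at t = 1 by the symmetry t -> 1/t. In u the
  products are polynomials with an informative first derivative at 0.\<close>

lemma sym_qpoch_eq:
  assumes "t \<noteq> 0" "u = t + 1 / t - 2"
  shows "sym_qpoch x p n u = qpoch (x * t) p n * qpoch (x / t) p n"
proof -
  have fac: "(1 - y) ^ 2 - y * u = (1 - y * t) * (1 - y / t)" for y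
    unfolding assms(2) using assms(1) by (simp add: field_simps power2_eq_square)
  thus ?thesis
    unfolding sym_qpoch_def qpoch_def prod.distrib [symmetric] fac by (simp add: mult_ac)
qed

lemma sym_qpoch_0: "sym_qpoch x p n 0 = qpoch x p n ^ 2"
  by (simp add: sym_qpoch_def qpoch_def prod_power_distrib)

text \<open>The numbers t and 1/t are the roots of z^2 - (2 + u) z + 1. As their product is 1, one
  of them lies in the closed unit disc; for it (1 - t)^2 = u t yields |1 - t| \<le> 1 - r, hence |t|
  \<ge> r.\<close>

lemma symmetric_parameter_exists:
  fixes u :: complex
  assumes "r < 1" "norm u < (1 - r) ^ 2"
  obtains t where "t \<noteq> 0" "r \<le> norm t" "norm t \<le> 1" "u = t + 1 / t - 2"
proof -
  define s where "s = csqrt ((2 + u) ^ 2 - 4)"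
  define t1 t2 where "t1 = (2 + u + s) / 2" and "t2 = (2 + u - s) / 2"
  have s: "s ^ 2 = (2 + u) ^ 2 - 4" by (simp add: s_def)
  have prod: "t1 * t2 = 1" and sum: "t1 + t2 = 2 + u"
    using s by (simp_all add: t1_def t2_def field_simps power2_eq_square)
  have "norm t1 * norm t2 = 1"
    using prod by (metis norm_mult norm_one)
  hence "\<not> (norm t1 > 1 \<and> norm t2 > 1)"
    using mult_strict_mono'[of 1 "norm t1" 1 "norm t2"] by auto
  moreover have "\<exists>t. t \<noteq> 0 \<and> norm t \<le> 1 \<and> u = t + 1 / t - 2"
    if "norm x \<le> 1" "x * y = 1" "x + y = 2 + u" for x y :: complex
  proof -
    have "x \<noteq> 0" using that by auto
    moreover from this have "y = 1 / x"
      using that by (simp add: nonzero_eq_divide_eq mult.commute)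
    moreover have "u = x + y - 2" using that by (simp add: algebra_simps)
    ultimately show ?thesis using that(1) by blast
  qed
  note this[of t1 t2] this[of t2 t1]
  ultimately obtain t where t: "t \<noteq> 0" "norm t \<le> 1" "u = t + 1 / t - 2"
    using prod sum by (auto simp: mult.commute add.commute not_less)
  have "(1 - t) ^ 2 = u * t"
    using t by (simp add: field_simps power2_eq_square)
  hence "norm (1 - t) ^ 2 = norm u * norm t"
    by (metis norm_mult norm_power)
  also have "\<dots> \<le> norm u"
    using t(2) by (simp add: mult_left_le)
  also have "\<dots> \<le> (1 - r) ^ 2"
    using assms(2) by (rule less_imp_le)
  finally have "norm (1 - t) \<le> 1 - r"
    by (rule power2_le_imp_le) (use assms(1) in simp)
  moreover have "norm (1 :: complex) \<le> norm (1 - t) + norm t"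
    using norm_triangle_ineq[of "1 - t" t] by simp
  ultimately have "r \<le> norm t" by simp
  with t that show ?thesis by blast
qed

text \<open>At a zero |1 - y|^2 = |y| |u| < (1 - r)^2, against |1 - y| \<ge> 1 - r.\<close>

lemma symmetric_factor_neq_0:
  fixes u y :: complex
  assumes "norm y \<le> r" "r < 1" "norm u < (1 - r) ^ 2"
  shows "(1 - y) ^ 2 - y * u \<noteq> 0"
proof
  assume "(1 - y) ^ 2 - y * u = 0"
  hence "norm (1 - y) ^ 2 = norm y * norm u"
    by (metis eq_iff_diff_eq_0 norm_mult norm_power)
  also have "\<dots> \<le> norm u"
    using assms by (intro mult_left_le_one_le) auto
  also have "\<dots> < (1 - r) ^ 2" by (rule assms(3))
  finally have "norm (1 - y) < 1 - r"
    by (rule power2_less_imp_less) (use assms(2) in simp)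
  moreover have "norm (1 :: complex) \<le> norm (1 - y) + norm y"
    using norm_triangle_ineq[of "1 - y" y] by simp
  ultimately show False using assms(1) by simp
qed

lemma norm_mult_power_le:
  fixes x p :: complex
  assumes "norm p \<le> 1"
  shows "norm (x * p ^ i) \<le> norm x"
  using assms by (simp add: norm_mult norm_power mult_left_le power_le_one)

lemma sym_qpoch_neq_0:
  assumes "norm x \<le> r" "norm p \<le> 1" "r < 1" "norm u < (1 - r) ^ 2"
  shows "sym_qpoch x p n u \<noteq> 0"
proof -
  have "(1 - x * p ^ i) ^ 2 - x * p ^ i * u \<noteq> 0" for i
    using norm_mult_power_le[OF assms(2), of x i] assms
    by (intro symmetric_factor_neq_0[of _ r]) auto
  thus ?thesis by (simp add: sym_qpoch_def)
qed

lemma holomorphic_sym_qpoch [holomorphic_intros]: "(\<lambda>u. sym_qpoch x p n u) holomorphic_on A"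
  unfolding sym_qpoch_def by (intro holomorphic_intros)

text \<open>The factor with y = x p^i has logarithmic derivative -y/(1 - y)^2 at u = 0. For y = q^j
  this is the summand q^j/[j]^2 of the theorem, up to sign and the factor (1 - q)^2.\<close>

lemma DERIV_sym_qpoch_0:
  assumes "norm x < 1" "norm p < 1"
  shows "(sym_qpoch x p n has_field_derivative
           - (qpoch x p n ^ 2 * (\<Sum>i<n. x * p ^ i / (1 - x * p ^ i) ^ 2))) (at 0)"
proof -
  have "((\<lambda>u. \<Prod>i<n. (1 - x * p ^ i) ^ 2 - x * p ^ i * u) has_field_derivative
      (\<Prod>i<n. (1 - x * p ^ i) ^ 2 - x * p ^ i * 0) *
      (\<Sum>i<n. - (x * p ^ i) / ((1 - x * p ^ i) ^ 2 - x * p ^ i * 0))) (at 0)"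
    using one_minus_mult_power_neq_0[OF assms]
    by (intro has_field_derivative_prod') (auto intro!: derivative_eq_intros)
  thus ?thesis
    by (simp add: sym_qpoch_def [abs_def] qpoch_def prod_power_distrib sum_negf)
qed

text \<open>The partial products converge uniformly on the closed unit disc, so the limit is
  holomorphic inside, and the logarithmic derivative of a nonvanishing infinite product is the sum
  of those of its factors.\<close>

lemma sym_qpoch_limit:
  assumes x: "norm x < 1" and p: "norm p < 1"
  obtains P where "\<And>u. norm u < 1 \<Longrightarrow> (\<lambda>n. sym_qpoch x p n u) \<longlonglongrightarrow> P u"
    and "P 0 = qpoch_inf x p ^ 2"
    and "(P has_field_derivative
           - (P 0 * (\<Sum>i. x * p ^ i / (1 - x * p ^ i) ^ 2))) (at 0)"
proof -
  define f where "f = (\<lambda>i u. (1 - x * p ^ i) ^ 2 - x * p ^ i * u)"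
  \<comment> \<open>The constant 4 is 1 + 2 + 1, bounding |y - 2 - u| for |y| \<le> 1 and |u| \<le>
    1.\<close>
  have bd: "norm (norm (f i u - 1)) \<le> 4 * norm p ^ i" if "u \<in> cball 0 1" for i u
  proof -
    define y where "y = x * p ^ i"
    have y1: "norm y \<le> norm p ^ i"
      unfolding y_def norm_mult norm_power using x by (intro mult_left_le_one_le) auto
    have y2: "norm y \<le> 1"
      unfolding y_def using p x norm_mult_power_le[of p x i] by linarith
    have "f i u - 1 = y * (y - 2 - u)"
      by (simp add: f_def y_def power2_eq_square algebra_simps)
    moreover have "norm (y - 2 - u) \<le> 1 + 2 + 1"
      using that y2 norm_triangle_ineq4[of "y - 2" u] norm_triangle_ineq4[of y 2] by simp
    ultimately show ?thesis
      using mult_mono[OF y1, of "norm (y - 2 - u)" 4] by (simp add: norm_mult mult.commute)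
  qed
  have "uniformly_convergent_on (cball 0 1) (\<lambda>N u. \<Prod>n<N. f n u)"
  proof (rule uniformly_convergent_on_prod')
    show "uniformly_convergent_on (cball 0 1) (\<lambda>N u. \<Sum>n<N. norm (f n u - 1))"
      using bd p by (intro Weierstrass_m_test'[of _ _ "\<lambda>i. 4 * norm p ^ i"] summable_mult summable_geometric) auto
  qed (auto simp: f_def intro!: continuous_intros)
  then obtain P where P: "uniform_limit (cball 0 1) (\<lambda>N u. \<Prod>n<N. f n u) P sequentially"
    by (auto simp: uniformly_convergent_on_def)
  have lim: "(\<lambda>n. sym_qpoch x p n u) \<longlonglongrightarrow> P u" if "norm u < 1" for u
    using tendsto_uniform_limitI[OF P, of u] that by (simp add: sym_qpoch_def f_def)
  have holo: "f k holomorphic_on A" for k A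
    unfolding f_def by (intro holomorphic_intros)
  have "P holomorphic_on ball 0 1"
  proof (rule holomorphic_uniform_sequence)
    fix z :: complex assume "z \<in> ball 0 1"
    then obtain d where "0 < d" "cball z d \<subseteq> ball 0 1"
      using open_contains_cball_eq[OF open_ball] by blast
    thus "\<exists>d>0. cball z d \<subseteq> ball 0 1 \<and> uniform_limit (cball z d) (\<lambda>N u. \<Prod>n<N. f n u) P sequentially"
      using uniform_limit_on_subset[OF P] ball_subset_cball by (metis order.trans)
  qed (auto intro!: holomorphic_intros holo)
  hence deriv: "(P has_field_derivative deriv P 0) (at 0)"
    by (intro holomorphic_derivI[of _ "ball 0 1"]) auto
  have "(\<lambda>n. sym_qpoch x p n 0) \<longlonglongrightarrow> qpoch_inf x p ^ 2"
    unfolding sym_qpoch_0 by (intro tendsto_power qpoch_LIMSEQ p)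
  hence P0: "P 0 = qpoch_inf x p ^ 2"
    using lim[of 0] LIMSEQ_unique by auto
  hence nz: "P 0 \<noteq> 0"
    using qpoch_inf_neq_0[OF x p] by simp
  have "(\<lambda>k. deriv (f k) 0 / f k 0) sums (deriv P 0 / P 0)"
    by (rule logderiv_prodinf_complex_uniform_limit
          [OF uniform_limit_on_subset[OF P ball_subset_cball] holo nz]) auto
  moreover have "deriv (f k) 0 = - (x * p ^ k)" for k
    unfolding f_def by (rule DERIV_imp_deriv) (auto intro!: derivative_eq_intros)
  ultimately have "(\<lambda>k. - (- (x * p ^ k / (1 - x * p ^ k) ^ 2))) sums - (deriv P 0 / P 0)"
    by (intro sums_minus) (simp add: f_def)
  hence "(\<Sum>k. x * p ^ k / (1 - x * p ^ k) ^ 2) = - (deriv P 0 / P 0)"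
    by (simp add: sums_iff)
  with deriv nz have D: "(P has_field_derivative
      - (P 0 * (\<Sum>i. x * p ^ i / (1 - x * p ^ i) ^ 2))) (at 0)"
    by simp
  show ?thesis using lim P0 D by (rule that)
qed

text \<open>Weierstrass: a majorised series of holomorphic functions may be differentiated term by
  term. Its sum agrees with G near 0, so uniqueness of the derivative identifies the sum of the d n
  with D.\<close>

lemma sums_derivative_at_0:
  fixes f :: "nat \<Rightarrow> complex \<Rightarrow> complex"
  assumes r: "0 < r" and M: "summable M"
    and bound: "\<And>n u. norm u < r \<Longrightarrow> norm (f n u) \<le> M n"
    and holo: "\<And>n. f n holomorphic_on ball 0 r"
    and deriv: "\<And>n. (f n has_field_derivative d n) (at 0)"
    and sums: "\<And>u. norm u < r \<Longrightarrow> (\<lambda>n. f n u) sums G u"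
    and G: "(G has_field_derivative D) (at 0)"
  shows "d sums D"
proof -
  have "\<exists>g g'. \<forall>u\<in>ball 0 r. (\<lambda>n. f n u) sums g u \<and> (\<lambda>n. deriv (f n) u) sums g' u
      \<and> (g has_field_derivative g' u) (at u)"
  proof (rule series_and_derivative_comparison_complex)
    fix u :: complex assume u: "u \<in> ball 0 r"
    have M0: "0 \<le> M n" for n
      using order_trans[OF norm_ge_zero bound[of 0 n]] r by simp
    show "\<exists>d h. 0 < d \<and> summable h \<and> range h \<subseteq> \<real>\<^sub>\<ge>\<^sub>0 \<and>
        (\<forall>\<^sub>F n in sequentially. \<forall>y\<in>ball u d \<inter> ball 0 r. norm (f n y) \<le> cmod (h n))"
      \<comment> \<open>The criterion expects the majorant as complex numbers on the nonnegative
        real axis.\<close>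
      by (rule exI[of _ 1], rule exI[of _ "\<lambda>n. complex_of_real (M n)"])
         (use M M0 bound in \<open>auto simp: summable_of_real intro!: always_eventually\<close>)
  qed (use holomorphic_derivI[OF holo] in auto)
  then obtain g g' where gg: "\<forall>u\<in>ball 0 r. (\<lambda>n. f n u) sums g u \<and> (\<lambda>n. deriv (f n) u) sums g' u
      \<and> (g has_field_derivative g' u) (at u)"
    by blast
  have g: "(\<lambda>n. f n u) sums g u" "(\<lambda>n. deriv (f n) u) sums g' u"
    "(g has_field_derivative g' u) (at u)" if "u \<in> ball 0 r" for u
    using gg that by blast+
  have eq: "g u = G u" if "u \<in> ball 0 r" for u
    using g(1)[OF that] sums[of u] that sums_unique2 by auto
  have "(G has_field_derivative g' 0) (at 0)"
    by (rule has_field_derivative_transform_within_open[OF g(3)[of 0], of "ball 0 r"])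
       (use r eq in auto)
  hence "g' 0 = D" using G by (rule DERIV_unique)
  moreover have "deriv (f n) 0 = d n" for n
    using deriv by (rule DERIV_imp_deriv)
  ultimately show ?thesis using g(2)[of 0] r by simp
qed

section \<open>The rational factors at the two parameter choices\<close>

definition base_weight :: "complex \<Rightarrow> nat \<Rightarrow> complex" where
  "base_weight q n = q ^ (6 * n ^ 2) * (qpoch q (q ^ 2) n ^ 6 / qpoch (q ^ 2) (q ^ 2) (2 * n) ^ 3)"

text \<open>Minus the logarithmic derivative at u = 0 of \<open>sym_qpoch\<close> with x = p = q^2
  and 2n factors; \<open>odd_sum\<close> plays the same part for x = q and n factors.\<close>

definition even_sum :: "complex \<Rightarrow> nat \<Rightarrow> complex" where
  "even_sum q n = (\<Sum>i<2*n. q ^ 2 * (q ^ 2) ^ i / (1 - q ^ 2 * (q ^ 2) ^ i) ^ 2)"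

definition odd_sum :: "complex \<Rightarrow> nat \<Rightarrow> complex" where
  "odd_sum q n = (\<Sum>i<n. q * (q ^ 2) ^ i / (1 - q * (q ^ 2) ^ i) ^ 2)"

text \<open>For x = p^n and X = q^(2n+1) this is \<open>dougall_factor\<close> at (q, qt, q/t),
  rewritten in u; \<open>odd_factor\<close> is the one at (qt, qt, qt).\<close>

definition even_factor :: "complex \<Rightarrow> complex \<Rightarrow> complex \<Rightarrow> complex" where
  "even_factor x X u = 1 - x ^ 2
     + x ^ 2 * (1 - X) ^ 2 * ((1 - X) ^ 2 * (1 + 2 * X + 2 * X ^ 2) + X ^ 4 * u)
       / ((1 - X ^ 2) * ((1 - X ^ 2) ^ 2 - X ^ 2 * u))"

definition odd_factor :: "complex \<Rightarrow> complex \<Rightarrow> complex \<Rightarrow> complex" where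
  "odd_factor x X u = 1 - x ^ 2
     + x ^ 2 * ((1 - X) ^ 2 - X * u) / (1 - X ^ 2) ^ 2
       * (1 - X ^ 2 + X ^ 2 * ((1 - X) ^ 2 - X * u) / (1 - X ^ 2))"

text \<open>\<open>dougall_factor\<close> is not visibly symmetric in b and c, but over a common
  denominator both numerator and denominator depend on t only through t + 1/t.\<close>

lemma even_factor_eq:
  assumes q: "q \<noteq> 0" and t: "t \<noteq> 0" "u = t + 1 / t - 2" and X: "X = q * x"
    and nz: "1 - X ^ 2 \<noteq> 0" "1 - X ^ 2 * t \<noteq> 0" "1 - X ^ 2 / t \<noteq> 0"
  shows "dougall_factor q (q * t) (q / t) (q ^ 2) x = even_factor x X u"
proof -
  define s where "s = 1 / t"
  have st: "s * t = 1" using t by (simp add: s_def)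
  have u: "u = t + s - 2" using t by (simp add: s_def)
  define d1 d2 d3 where "d1 = 1 - X ^ 2" and "d2 = 1 - X ^ 2 * s" and "d3 = 1 - X ^ 2 * t"
  have d: "d1 \<noteq> 0" "d2 \<noteq> 0" "d3 \<noteq> 0"
    using nz by (simp_all add: d1_def d2_def d3_def s_def)
  have "dougall_factor q (q * t) (q / t) (q ^ 2) x =
      1 - x ^ 2 + x ^ 2 * (1 - X) * (1 - X) / (d2 * d3)
        * (d2 + X ^ 2 * s * (1 - X * t) * (1 - X * t) / d1)"
    unfolding dougall_factor_def shift_ratio_def d1_def d2_def d3_def s_def X
    using q t(1) by (simp add: power2_eq_square mult_ac)
  also have "\<dots> = 1 - x ^ 2 + x ^ 2 * (1 - X) ^ 2 *
      (d1 * d2 + X ^ 2 * s * (1 - X * t) ^ 2) / (d1 * (d2 * d3))"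
    using d by (simp add: field_simps power2_eq_square)
  also have "d2 * d3 = (1 - X ^ 2) ^ 2 - X ^ 2 * u"
    unfolding d2_def d3_def u using st by algebra
  also have "d1 * d2 + X ^ 2 * s * (1 - X * t) ^ 2
      = (1 - X) ^ 2 * (1 + 2 * X + 2 * X ^ 2) + X ^ 4 * u"
    unfolding d1_def d2_def u using st by algebra
  finally show ?thesis
    by (simp only: even_factor_def d1_def)
qed

lemma odd_factor_eq:
  assumes q: "q \<noteq> 0" and t: "t \<noteq> 0" "u = t + 1 / t - 2" and X: "X = q * x"
  shows "dougall_factor (q * t) (q * t) (q * t) (q ^ 2) x = odd_factor x X u"
proof -
  have w: "(1 - X * t) * (1 - X / t) = (1 - X) ^ 2 - X * u"
    unfolding t(2) using t(1) by (simp add: field_simps power2_eq_square)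
  have "dougall_factor (q * t) (q * t) (q * t) (q ^ 2) x =
      1 - x ^ 2 + x ^ 2 * ((1 - X * t) * (1 - X / t)) / (1 - X ^ 2) ^ 2
        * (1 - X ^ 2 + X ^ 2 * ((1 - X * t) * (1 - X / t)) / (1 - X ^ 2))"
    unfolding dougall_factor_def shift_ratio_def X
    using q t(1) by (simp add: power2_eq_square mult_ac)
  thus ?thesis unfolding w odd_factor_def .
qed

text \<open>At x = q^(2k) the value is q^(1+6k) times the second quotient in
  \<open>nu_q\<close>.\<close>

lemma even_factor_deriv_0:
  assumes "1 - X \<noteq> 0" "1 + X \<noteq> 0"
  shows "(even_factor x X has_field_derivative
           x ^ 2 * X ^ 2 * (1 + X + X ^ 2) ^ 2 / ((1 - X) * (1 + X) ^ 5)) (at 0)"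
proof -
  have f: "1 - X ^ 2 = (1 - X) * (1 + X)"
    by (simp add: power2_eq_square algebra_simps)
  have nz: "1 - X ^ 2 \<noteq> 0" using assms by (simp add: f)
  have gen: "((\<lambda>u. A + P * (B + C * u) / (Q * (R - E * u))) has_field_derivative
      P * (C * (Q * R) + B * (Q * E)) / (Q * R) ^ 2) (at 0)"
    if "Q \<noteq> 0" "R \<noteq> 0" for A P B C Q R E :: complex
    using that by (auto intro!: derivative_eq_intros simp: power2_eq_square algebra_simps)
  have "(even_factor x X has_field_derivative
      x ^ 2 * (1 - X) ^ 2 * (X ^ 4 * ((1 - X ^ 2) * (1 - X ^ 2) ^ 2)
        + (1 - X) ^ 2 * (1 + 2 * X + 2 * X ^ 2) * ((1 - X ^ 2) * X ^ 2))
      / ((1 - X ^ 2) * (1 - X ^ 2) ^ 2) ^ 2) (at 0)"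
    unfolding even_factor_def [abs_def]
    using nz by (intro gen) auto
  also have "x ^ 2 * (1 - X) ^ 2 * (X ^ 4 * ((1 - X ^ 2) * (1 - X ^ 2) ^ 2)
        + (1 - X) ^ 2 * (1 + 2 * X + 2 * X ^ 2) * ((1 - X ^ 2) * X ^ 2))
      / ((1 - X ^ 2) * (1 - X ^ 2) ^ 2) ^ 2
      = x ^ 2 * X ^ 2 * (1 + X + X ^ 2) ^ 2 / ((1 - X) * (1 + X) ^ 5)"
  proof -
    define a b where "a = 1 - X" and "b = 1 + X"
    have ab: "a \<noteq> 0" "b \<noteq> 0" using assms by (simp_all add: a_def b_def)
    \<comment> \<open>After extracting a^3 b X^2 this is X^2 (1 + X)^2 + 1 + 2X + 2X^2 = (1 + X +
      X^2)^2, the source of the square in \<open>nu_q\<close>.\<close>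
    have 1: "X ^ 4 * ((a * b) * (a * b) ^ 2) + a ^ 2 * (1 + 2 * X + 2 * X ^ 2) * ((a * b) * X ^ 2)
        = a ^ 3 * b * X ^ 2 * (1 + X + X ^ 2) ^ 2"
      unfolding a_def b_def by algebra
    have "x ^ 2 * a ^ 2 * (a ^ 3 * b * X ^ 2 * (1 + X + X ^ 2) ^ 2) / ((a * b) * (a * b) ^ 2) ^ 2
        = x ^ 2 * X ^ 2 * (1 + X + X ^ 2) ^ 2 / (a * b ^ 5)"
      using ab by (simp add: divide_simps) (simp add: algebra_simps power_numeral_reduce)
    thus ?thesis unfolding f a_def [symmetric] b_def [symmetric] 1 .
  qed
  finally show ?thesis .
qed

text \<open>Up to sign and the constant 3(1+q)^3/64, this produces the first quotient in
  \<open>nu_q\<close>, again multiplied by q^(1+6k).\<close>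

lemma odd_factor_deriv_0:
  assumes "1 - X \<noteq> 0" "1 + X \<noteq> 0"
  shows "(odd_factor x X has_field_derivative
           - (x ^ 2 * X * (1 + 2 * X + 3 * X ^ 2) / ((1 - X) * (1 + X) ^ 3))) (at 0)"
proof -
  have f: "1 - X ^ 2 = (1 - X) * (1 + X)"
    by (simp add: power2_eq_square algebra_simps)
  have nz: "1 - X ^ 2 \<noteq> 0" using assms by (simp add: f)
  have gen: "((\<lambda>u. A + P * (w - X * u) / Q ^ 2 * (Q + E * (w - X * u) / Q)) has_field_derivative
      - (P * X) / Q ^ 2 * (Q + E * w / Q) + P * w / Q ^ 2 * (- (E * X) / Q)) (at 0)"
    if "Q \<noteq> 0" for A P w Q E :: complex
    using that by (auto intro!: derivative_eq_intros simp: field_simps power2_eq_square)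
  have "(odd_factor x X has_field_derivative
      - (x ^ 2 * X) / (1 - X ^ 2) ^ 2 * (1 - X ^ 2 + X ^ 2 * (1 - X) ^ 2 / (1 - X ^ 2))
      + x ^ 2 * (1 - X) ^ 2 / (1 - X ^ 2) ^ 2 * (- (X ^ 2 * X) / (1 - X ^ 2))) (at 0)"
    unfolding odd_factor_def [abs_def]
    using nz by (rule gen)
  also have "- (x ^ 2 * X) / (1 - X ^ 2) ^ 2 * (1 - X ^ 2 + X ^ 2 * (1 - X) ^ 2 / (1 - X ^ 2))
      + x ^ 2 * (1 - X) ^ 2 / (1 - X ^ 2) ^ 2 * (- (X ^ 2 * X) / (1 - X ^ 2))
      = - (x ^ 2 * X * (1 + 2 * X + 3 * X ^ 2) / ((1 - X) * (1 + X) ^ 3))"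
  proof -
    define a b where "a = 1 - X" and "b = 1 + X"
    have ab: "a \<noteq> 0" "b \<noteq> 0" using assms by (simp_all add: a_def b_def)
    have 1: "1 + 2 * X + 3 * X ^ 2 = b ^ 2 + 2 * X ^ 2"
      unfolding b_def by (simp add: power2_eq_square algebra_simps)
    show ?thesis unfolding f a_def [symmetric] b_def [symmetric] 1
      using ab by (simp add: divide_simps) (simp add: algebra_simps power_numeral_reduce)
  qed
  finally show ?thesis .
qed

text \<open>At t = 1 both parameter choices become a = b = c = q, so the factors agree, just as both
  weights become \<open>base_weight\<close>. The two differentiated series can therefore be combined
  term by term.\<close>

lemma odd_factor_0_eq:
  assumes "1 - X \<noteq> 0" "1 + X \<noteq> 0"
  shows "odd_factor x X 0 = even_factor x X 0"
proof -
  have f: "1 - X ^ 2 = (1 - X) * (1 + X)"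
    by (simp add: power2_eq_square algebra_simps)
  define a b where "a = 1 - X" and "b = 1 + X"
  have ab: "a \<noteq> 0" "b \<noteq> 0" using assms by (simp_all add: a_def b_def)
  have 1: "1 + 2 * X + 2 * X ^ 2 = b ^ 2 + X ^ 2"
    unfolding b_def by (simp add: power2_eq_square algebra_simps)
  show ?thesis
    unfolding odd_factor_def even_factor_def f a_def [symmetric] b_def [symmetric] 1
    using ab by (simp add: divide_simps) (simp add: algebra_simps power_numeral_reduce)
qed

text \<open>Turns the k-dependent powers in \<open>lambda_q\<close>, \<open>mu_q\<close> and
  \<open>nu_q\<close> into monomials in q, x and X, so that the comparisons become polynomial
  identities.\<close>

lemma power_conversions:
  fixes q :: complex
  assumes "x = (q ^ 2) ^ k" "X = q * x"
  shows "q ^ (1 + 2 * k) = X" "q ^ (1 + 6 * k) = X * x ^ 2" "q ^ (3 + 2 * k) = q ^ 2 * X"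
    "q ^ (3 + 6 * k) = q ^ 2 * (X * x ^ 2)" "q ^ (2 + 4 * k) = X ^ 2"
    "q ^ (2 + 8 * k) = X ^ 2 * x ^ 2" "q ^ (3 + 10 * k) = X ^ 3 * x ^ 2"
  unfolding assms by (simp_all flip: power_mult power_add power_Suc) (simp_all add: numeral_3_eq_3)

text \<open>Over the denominator (1 - X)(1 + X)^3 the numerators agree once X = q x is used to trade
  X^2 for q^2 x^2.\<close>

lemma even_factor_0_eq_lambda:
  assumes q: "norm q < 1"
  shows "even_factor ((q ^ 2) ^ k) (q * (q ^ 2) ^ k) 0 = (1 - q) * lambda_q q k"
proof -
  define x where "x = (q ^ 2) ^ k"
  define X where "X = q * x"
  note e = power_conversions[OF x_def X_def]
  have X: "X \<noteq> 1" "X \<noteq> - 1"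
    using power_neq_one[OF q, of "1 + 2 * k"] unfolding e(1) by simp_all
  define a b where "a = 1 - X" and "b = 1 + X"
  have ab: "a \<noteq> 0" "b \<noteq> 0"
    using X by (auto simp: a_def b_def add_eq_0_iff minus_equation_iff[of X])
  have q1: "1 - q \<noteq> 0" using q by auto
  have f: "1 - X ^ 2 = a * b"
    by (simp add: a_def b_def power2_eq_square algebra_simps)
  have num: "(1 - x ^ 2) * (a * b ^ 3) + x ^ 2 * a ^ 2 * (1 + 2 * X + 2 * X ^ 2)
      = 1 + 2 * X - X * x ^ 2 * (2 + 2 * q ^ 2 + X + q ^ 2 * X - 3 * (q ^ 2 * (X * x ^ 2)))"
    unfolding a_def b_def X_def by algebra
  have "even_factor x X 0 = 1 - x ^ 2 + x ^ 2 * a ^ 2 * (a ^ 2 * (1 + 2 * X + 2 * X ^ 2)) / ((a * b) * (a * b) ^ 2)"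
    by (simp add: even_factor_def f a_def)
  also have "\<dots> = ((1 - x ^ 2) * (a * b ^ 3) + x ^ 2 * a ^ 2 * (1 + 2 * X + 2 * X ^ 2)) / (a * b ^ 3)"
    using ab by (simp add: divide_simps) (simp add: algebra_simps power_numeral_reduce)
  also have "\<dots> = (1 - q) * lambda_q q k"
    unfolding lambda_q_def e num a_def [symmetric] b_def [symmetric] using q1 by simp
  finally show ?thesis by (simp add: X_def x_def)
qed

text \<open>In the even series minus c = 3(1+q)^3/64 times the odd one, the odd sum has coefficient
  -(2 + 3c). The numerator of \<open>lambda_q\<close> is divisible by 1 - X, and 64(2 + 3c) = 128 +
  9(1+q)^3 explains the factor starting with 137.\<close>

lemma mu_q_eq:
  assumes q: "norm q < 1"
  shows "mu_q q k = lambda_q q k * (2 + 3 * (3 * (1 + q) ^ 3 / 64))"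
proof -
  define x where "x = (q ^ 2) ^ k"
  define X where "X = q * x"
  note e = power_conversions[OF x_def X_def]
  have X: "X \<noteq> 1" "X \<noteq> - 1"
    using power_neq_one[OF q, of "1 + 2 * k"] unfolding e(1) by simp_all
  hence a: "1 - X \<noteq> 0" by simp
  have num: "1 + 2 * X - X * x ^ 2 * (2 + 2 * q ^ 2 + X + q ^ 2 * X - 3 * (q ^ 2 * (X * x ^ 2)))
      = (1 - X) * (1 + 3 * X + 3 * X ^ 2 - 2 * (X * x ^ 2) + q ^ 2 * (X * x ^ 2)
        - 3 * (X ^ 2 * x ^ 2) - 3 * (X ^ 3 * x ^ 2))"
    unfolding X_def by algebra
  have c: "137 + 27 * q + 27 * q ^ 2 + 9 * q ^ 3 = 64 * (2 + 3 * (3 * (1 + q) ^ 3 / 64))"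
    by (simp add: power2_eq_square power3_eq_cube algebra_simps)
  have "N / (64 * d * b * inverse (64 * C)) = z * N / (d * z * b) * C"
    if "z \<noteq> 0" for N d b C z :: complex
    using that by (simp add: field_simps)
  from this[OF a] show ?thesis
    unfolding mu_q_def lambda_q_def e num c .
qed

section \<open>The two differentiated series\<close>

lemma base_weight_eq:
  "base_weight q n = (q ^ 2) ^ (3 * n ^ 2) * (qpoch q (q ^ 2) n ^ 6 / qpoch (q ^ 2) (q ^ 2) (2 * n) ^ 3)"
  by (simp add: base_weight_def flip: power_mult)

text \<open>Derivative at u = 0 for (a, b, c) = (q, qt, q/t). Here t enters the weight through a
  square in the numerator and one symmetric product of length 2n in the denominator, and the closed
  form through 1/P u.\<close>

lemma even_series_sums:
  assumes q: "norm q < 1" "q \<noteq> 0"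
  defines "X \<equiv> (\<lambda>n. q * (q ^ 2) ^ n)"
  shows "(\<lambda>n. base_weight q n * (even_factor ((q ^ 2) ^ n) (X n) 0 * (even_sum q n - 2 * odd_sum q n)
            + ((q ^ 2) ^ n) ^ 2 * X n ^ 2 * (1 + X n + X n ^ 2) ^ 2 / ((1 - X n) * (1 + X n) ^ 5)))
         sums (qpoch_inf q (q ^ 2) ^ 2 / qpoch_inf (q ^ 2) (q ^ 2) ^ 2
               * (\<Sum>i. q ^ 2 * (q ^ 2) ^ i / (1 - q ^ 2 * (q ^ 2) ^ i) ^ 2))"
proof -
  define p where "p = q ^ 2"
  \<comment> \<open>On the disc of this radius a suitable t exists and the u-dependent denominators
    are nonzero.\<close>
  define r where "r = (1 - norm q) ^ 2"
  define F where "F = (\<lambda>n u. p ^ (3 * n ^ 2) * qpoch q p n ^ 2 * sym_qpoch q p n u ^ 2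
      / (qpoch p p (2 * n) * sym_qpoch p p (2 * n) u) * even_factor (p ^ n) (X n) u)"
  have np: "norm p \<le> norm q" and p1: "norm p < 1"
    using q power_decreasing[of 1 2 "norm q"] by (auto simp: p_def norm_power power_less_one_iff)
  have r: "0 < r" "r \<le> 1"
    using q by (auto simp: r_def power_le_one)
  have X: "X n = q * p ^ n" "1 - X n \<noteq> 0" "1 + X n \<noteq> 0" "X n ^ 2 = p * p ^ (2 * n)" for n
  proof -
    show "X n = q * p ^ n" by (simp add: X_def p_def)
    have "X n = q ^ (1 + 2 * n)" by (simp add: X_def power_mult)
    thus "1 - X n \<noteq> 0" "1 + X n \<noteq> 0"
      using power_neq_one[OF q(1), of "1 + 2 * n"] by (simp_all add: add_eq_0_iff minus_equation_iff[of "X n"])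
    show "X n ^ 2 = p * p ^ (2 * n)"
      by (simp add: X_def p_def power_mult_distrib power_mult mult.commute flip: power_mult)
  qed
  \<comment> \<open>The constants \<rho> = |q| and K = 1 serve for the whole disc: |q| \<le> |t|
    \<le> 1 gives |p/t| \<le> |q|, |pt| \<le> |q| and |q/t| \<le> 1, while a^2/(bc) = 1.\<close>
  obtain M where M: "summable M"
     "\<And>a b c p n. admissible (norm q) 1 a b c p \<Longrightarrow> norm (dougall_weight a b c p n) \<le> M n"
     "\<And>a b c p n. admissible (norm q) 1 a b c p \<Longrightarrow>
           norm (dougall_weight a b c p n * dougall_factor a b c p (p ^ n)) \<le> M n"
    using dougall_majorant[of "norm q" 1] q by auto
  obtain P where P: "\<And>u. norm u < 1 \<Longrightarrow> (\<lambda>n. sym_qpoch p p n u) \<longlonglongrightarrow> P u"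
    "P 0 = qpoch_inf p p ^ 2"
    "(P has_field_derivative - (P 0 * (\<Sum>i. p * p ^ i / (1 - p * p ^ i) ^ 2))) (at 0)"
    using sym_qpoch_limit[OF p1 p1] by blast
  have P0: "P 0 \<noteq> 0"
    using P(2) qpoch_inf_neq_0[OF p1 p1] by simp
  have param: "(\<forall>n. norm (F n u) \<le> M n) \<and> (\<lambda>n. F n u) sums (qpoch_inf q p ^ 2 / P u)"
    if u: "norm u < r" for u
  proof -
    obtain t where t: "t \<noteq> 0" "norm q \<le> norm t" "norm t \<le> 1" "u = t + 1 / t - 2"
      using symmetric_parameter_exists[OF q(1)] u unfolding r_def by blast
    have simps: "q * p / (q * t) = p / t" "q * p / (q / t) = p * t" "p / (q * t) = q / t" "p / (q / t) = q * t"
      "q * p / (q * t * (q / t)) = q" "q ^ 2 / (q * t * (q / t)) = 1"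
      using q(2) t(1) by (simp_all add: p_def power2_eq_square)
    have pt: "norm (p / t) \<le> norm q" "norm (p * t) \<le> norm q"
      using q t np mult_mono[of "norm p" "norm q" "norm t" 1]
        mult_left_mono[OF t(2), of "norm q"]
      by (auto simp: p_def norm_divide norm_mult norm_power divide_simps power2_eq_square)
    have qt: "norm (q / t) \<le> 1" "norm (q * t) \<le> 1"
      using q t by (auto simp: norm_divide norm_mult divide_simps mult_le_one)
    have adm: "admissible (norm q) 1 q (q * t) (q / t) p"
      unfolding admissible_def simps using q t np pt qt by auto
    have nz: "1 - X n ^ 2 \<noteq> 0" "1 - X n ^ 2 * t \<noteq> 0" "1 - X n ^ 2 / t \<noteq> 0" for n
      using one_minus_mult_power_neq_0[OF p1 p1, of "2 * n"]
        one_minus_mult_power_neq_0[of "p * t" p "2 * n"] one_minus_mult_power_neq_0[of "p / t" p "2 * n"]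
        p1 pt q(1) by (simp_all add: X(4) mult_ac)
    have F: "F n u = dougall_weight q (q * t) (q / t) p n * dougall_factor q (q * t) (q / t) p (p ^ n)" for n
      unfolding even_factor_eq[OF q(2) t(1,4) X(1)[unfolded p_def] nz, folded p_def]
      unfolding F_def dougall_weight_def simps sym_qpoch_eq[OF t(1,4)]
      by (simp add: power2_eq_square mult_ac)
    have "(\<lambda>n. sym_qpoch p p n u) \<longlonglongrightarrow> qpoch_inf (p * t) p * qpoch_inf (p / t) p"
      unfolding sym_qpoch_eq[OF t(1,4)] by (intro tendsto_mult qpoch_LIMSEQ p1)
    hence Pu: "P u = qpoch_inf (p * t) p * qpoch_inf (p / t) p"
      using P(1)[of u] u r(2) by (intro LIMSEQ_unique[of "\<lambda>n. sym_qpoch p p n u"]) auto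
    have "(\<lambda>n. dougall_weight q (q * t) (q / t) p n * dougall_factor q (q * t) (q / t) p (p ^ n)) sums
        (qpoch_inf q p * qpoch_inf (q * p / (q * t * (q / t))) p /
        (qpoch_inf (q * p / (q * t)) p * qpoch_inf (q * p / (q / t)) p))"
      by (rule dougall_series_sums) (use q(2) t(1) p1 pt q(1) in \<open>auto simp: simps\<close>)
    hence "(\<lambda>n. F n u) sums (qpoch_inf q p ^ 2 / P u)"
      unfolding simps F Pu by (simp add: power2_eq_square mult_ac)
    thus ?thesis using M(3)[OF adm] unfolding F by blast
  qed
  \<comment> \<open>As a function of u, t branches at 0, so holomorphy is read off from the
    expression in u alone.\<close>
  have holo: "F n holomorphic_on ball 0 r" for n
  proof -
    have 1: "(1 - X n ^ 2) * ((1 - X n ^ 2) ^ 2 - X n ^ 2 * u) \<noteq> 0" if "u \<in> ball 0 r" for u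
    proof -
      have "norm (X n ^ 2) \<le> norm q"
        unfolding X(4) using norm_mult_power_le[of p p "2 * n"] p1 np by simp
      from symmetric_factor_neq_0[OF this q(1), of u] symmetric_factor_neq_0[OF this q(1), of 0]
      show ?thesis using that r(1) by (auto simp: r_def)
    qed
    have 2: "qpoch p p (2 * n) * sym_qpoch p p (2 * n) u \<noteq> 0" if "u \<in> ball 0 r" for u
      using sym_qpoch_neq_0[OF np _ q(1), of p u] qpoch_neq_0[OF p1 p1] p1 that by (auto simp: r_def)
    show ?thesis
      unfolding F_def even_factor_def using 1 2 by (intro holomorphic_intros) blast+
  qed
  have deriv: "(F n has_field_derivative base_weight q n *
      (even_factor ((q ^ 2) ^ n) (X n) 0 * (even_sum q n - 2 * odd_sum q n)
            + ((q ^ 2) ^ n) ^ 2 * X n ^ 2 * (1 + X n + X n ^ 2) ^ 2 / ((1 - X n) * (1 + X n) ^ 5))) (at 0)" for n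
  proof -
    \<comment> \<open>A and B have logarithmic derivatives -a and -b at 0, so A^2/B has b - 2a: the
      combination \<open>even_sum\<close> - 2 \<open>odd_sum\<close>.\<close>
    have gen: "((\<lambda>u. W * A u ^ 2 / (Q * B u)) has_field_derivative (W * A 0 ^ 2 / (Q * B 0)) * (b - 2 * a)) (at 0)"
      if "(A has_field_derivative - (A 0 * a)) (at 0)" "(B has_field_derivative - (B 0 * b)) (at 0)"
        "B 0 \<noteq> 0" "Q \<noteq> 0" for A B :: "complex \<Rightarrow> complex" and W Q a b
      using that by (auto intro!: derivative_eq_intros simp: field_simps power2_eq_square)
    have D: "((\<lambda>u. p ^ (3 * n ^ 2) * qpoch q p n ^ 2 * sym_qpoch q p n u ^ 2
      / (qpoch p p (2 * n) * sym_qpoch p p (2 * n) u)) has_field_derivative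
      p ^ (3 * n ^ 2) * qpoch q p n ^ 2 * sym_qpoch q p n 0 ^ 2
      / (qpoch p p (2 * n) * sym_qpoch p p (2 * n) 0) * (even_sum q n - 2 * odd_sum q n)) (at 0)"
      using DERIV_sym_qpoch_0[OF q(1) p1, of n] DERIV_sym_qpoch_0[OF p1 p1, of "2 * n"] qpoch_neq_0[OF p1 p1]
      by (intro gen) (simp_all add: sym_qpoch_0 even_sum_def odd_sum_def p_def)
    have v: "p ^ (3 * n ^ 2) * qpoch q p n ^ 2 * sym_qpoch q p n 0 ^ 2
      / (qpoch p p (2 * n) * sym_qpoch p p (2 * n) 0) = base_weight q n"
      unfolding base_weight_eq sym_qpoch_0 p_def [symmetric] by (simp add: power_numeral_reduce mult_ac)
    show ?thesis
      unfolding F_def p_def [symmetric]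
      by (rule DERIV_cong[OF DERIV_mult[OF D even_factor_deriv_0[OF X(2)[of n] X(3)[of n], of "p ^ n"]]], unfold v)
         (simp only: distrib_left mult_ac)
  qed
  have "((\<lambda>u. qpoch_inf q p ^ 2 / P u) has_field_derivative
      qpoch_inf q p ^ 2 / qpoch_inf p p ^ 2 * (\<Sum>i. p * p ^ i / (1 - p * p ^ i) ^ 2)) (at 0)"
    using P0 by (auto intro!: derivative_eq_intros P(3) simp: P(2) power2_eq_square)
  from sums_derivative_at_0[where f = F, OF r(1) M(1) _ holo deriv _ this] param
  show ?thesis unfolding p_def by blast
qed

text \<open>Derivative at u = 0 for a = b = c = qt. Now ap/b = ap/c = p, so t disappears from the
  denominators; it remains in a cube of symmetric products and in the numerator P u of the closed
  form.\<close>

lemma odd_series_sums: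
  assumes q: "norm q < 1" "q \<noteq> 0"
  defines "X \<equiv> (\<lambda>n. q * (q ^ 2) ^ n)"
  shows "(\<lambda>n. base_weight q n * (even_factor ((q ^ 2) ^ n) (X n) 0 * (3 * odd_sum q n)
            + ((q ^ 2) ^ n) ^ 2 * X n * (1 + 2 * X n + 3 * X n ^ 2) / ((1 - X n) * (1 + X n) ^ 3)))
         sums (qpoch_inf q (q ^ 2) ^ 2 / qpoch_inf (q ^ 2) (q ^ 2) ^ 2
               * (\<Sum>i. q * (q ^ 2) ^ i / (1 - q * (q ^ 2) ^ i) ^ 2))"
proof -
  define p where "p = q ^ 2"
  define r where "r = (1 - norm q) ^ 2"
  define F where "F = (\<lambda>n u. p ^ (3 * n ^ 2) / qpoch p p (2 * n) ^ 3 * sym_qpoch q p n u ^ 3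
      * odd_factor (p ^ n) (X n) u)"
  have np: "norm p \<le> norm q" and p1: "norm p < 1"
    using q power_decreasing[of 1 2 "norm q"] by (auto simp: p_def norm_power power_less_one_iff)
  have r: "0 < r" "r \<le> 1"
    using q by (auto simp: r_def power_le_one)
  have X: "X n = q * p ^ n" "1 - X n \<noteq> 0" "1 + X n \<noteq> 0" for n
  proof -
    show "X n = q * p ^ n" by (simp add: X_def p_def)
    have "X n = q ^ (1 + 2 * n)" by (simp add: X_def power_mult)
    thus "1 - X n \<noteq> 0" "1 + X n \<noteq> 0"
      using power_neq_one[OF q(1), of "1 + 2 * n"] by (simp_all add: add_eq_0_iff minus_equation_iff[of "X n"])
  qed
  obtain M where M: "summable M"
     "\<And>a b c p n. admissible (norm q) 1 a b c p \<Longrightarrow> norm (dougall_weight a b c p n) \<le> M n"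
     "\<And>a b c p n. admissible (norm q) 1 a b c p \<Longrightarrow>
           norm (dougall_weight a b c p n * dougall_factor a b c p (p ^ n)) \<le> M n"
    using dougall_majorant[of "norm q" 1] q by auto
  obtain P where P: "\<And>u. norm u < 1 \<Longrightarrow> (\<lambda>n. sym_qpoch q p n u) \<longlonglongrightarrow> P u"
    "P 0 = qpoch_inf q p ^ 2"
    "(P has_field_derivative - (P 0 * (\<Sum>i. q * p ^ i / (1 - q * p ^ i) ^ 2))) (at 0)"
    using sym_qpoch_limit[OF q(1) p1] by blast
  have param: "(\<forall>n. norm (F n u) \<le> M n) \<and> (\<lambda>n. F n u) sums (P u / qpoch_inf p p ^ 2)"
    if u: "norm u < r" for u
  proof -
    obtain t where t: "t \<noteq> 0" "norm q \<le> norm t" "norm t \<le> 1" "u = t + 1 / t - 2"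
      using symmetric_parameter_exists[OF q(1)] u unfolding r_def by blast
    have simps: "q * t * p / (q * t) = p" "p / (q * t) = q / t"
      "q * t * p / (q * t * (q * t)) = q / t" "(q * t) ^ 2 / (q * t * (q * t)) = 1"
      using q(2) t(1) by (simp_all add: p_def power2_eq_square)
    have qt: "norm (q / t) \<le> 1" "norm (q * t) \<le> 1"
      using q t by (auto simp: norm_divide norm_mult divide_simps mult_le_one)
    have adm: "admissible (norm q) 1 (q * t) (q * t) (q * t) p"
      unfolding admissible_def simps using q t np qt by auto
    have F: "F n u = dougall_weight (q * t) (q * t) (q * t) p n
        * dougall_factor (q * t) (q * t) (q * t) p (p ^ n)" for n
      unfolding odd_factor_eq[OF q(2) t(1,4) X(1)[unfolded p_def], folded p_def]
      unfolding F_def dougall_weight_def simps sym_qpoch_eq[OF t(1,4)]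
      by (simp add: power3_eq_cube mult_ac)
    have "(\<lambda>n. sym_qpoch q p n u) \<longlonglongrightarrow> qpoch_inf (q * t) p * qpoch_inf (q / t) p"
      unfolding sym_qpoch_eq[OF t(1,4)] by (intro tendsto_mult qpoch_LIMSEQ p1)
    hence Pu: "P u = qpoch_inf (q * t) p * qpoch_inf (q / t) p"
      using P(1)[of u] u r(2) by (intro LIMSEQ_unique[of "\<lambda>n. sym_qpoch q p n u"]) auto
    have "(\<lambda>n. dougall_weight (q * t) (q * t) (q * t) p n
          * dougall_factor (q * t) (q * t) (q * t) p (p ^ n)) sums
        (qpoch_inf (q * t) p * qpoch_inf (q * t * p / (q * t * (q * t))) p /
        (qpoch_inf (q * t * p / (q * t)) p * qpoch_inf (q * t * p / (q * t)) p))"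
      by (rule dougall_series_sums) (use q(2) t(1) p1 in \<open>auto simp: simps\<close>)
    hence "(\<lambda>n. F n u) sums (P u / qpoch_inf p p ^ 2)"
      unfolding simps F Pu by (simp add: power2_eq_square)
    thus ?thesis using M(3)[OF adm] unfolding F by blast
  qed
  have X2: "1 - X n ^ 2 \<noteq> 0" for n
    using X(2,3)[of n] by (simp add: power2_eq_1_iff add_eq_0_iff minus_equation_iff[of "X n"])
  have holo: "F n holomorphic_on ball 0 r" for n
    unfolding F_def odd_factor_def using X2[of n] qpoch_neq_0[OF p1 p1, of "2 * n"]
    by (intro holomorphic_intros) auto
  have deriv: "(F n has_field_derivative - (base_weight q n *
      (even_factor ((q ^ 2) ^ n) (X n) 0 * (3 * odd_sum q n)
            + ((q ^ 2) ^ n) ^ 2 * X n * (1 + 2 * X n + 3 * X n ^ 2) / ((1 - X n) * (1 + X n) ^ 3)))) (at 0)" for n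
  proof -
    have gen: "((\<lambda>u. W * A u ^ 3) has_field_derivative (W * A 0 ^ 3) * - (3 * a)) (at 0)"
      if "(A has_field_derivative - (A 0 * a)) (at 0)" for A :: "complex \<Rightarrow> complex" and W a
      using that by (auto intro!: derivative_eq_intros simp: power2_eq_square power3_eq_cube)
    have D: "((\<lambda>u. p ^ (3 * n ^ 2) / qpoch p p (2 * n) ^ 3 * sym_qpoch q p n u ^ 3) has_field_derivative
        p ^ (3 * n ^ 2) / qpoch p p (2 * n) ^ 3 * sym_qpoch q p n 0 ^ 3 * - (3 * odd_sum q n)) (at 0)"
      using DERIV_sym_qpoch_0[OF q(1) p1, of n]
      by (intro gen) (simp add: sym_qpoch_0 odd_sum_def p_def)
    have v: "p ^ (3 * n ^ 2) / qpoch p p (2 * n) ^ 3 * sym_qpoch q p n 0 ^ 3 = base_weight q n"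
      unfolding base_weight_eq sym_qpoch_0 p_def [symmetric] by (simp flip: power_mult)
    \<comment> \<open>The product rule leaves \<open>odd_factor\<close> at u = 0, which is exchanged
      for \<open>even_factor\<close> to match the other series.\<close>
    show ?thesis
      unfolding F_def p_def [symmetric]
      by (rule DERIV_cong[OF DERIV_mult[OF D odd_factor_deriv_0[OF X(2)[of n] X(3)[of n], of "p ^ n"]]],
          unfold v odd_factor_0_eq[OF X(2)[of n] X(3)[of n]])
         (simp only: distrib_left mult_ac minus_add_distrib mult_minus_right mult_minus_left)
  qed
  have G: "((\<lambda>u. P u / qpoch_inf p p ^ 2) has_field_derivative
      - (qpoch_inf q p ^ 2 / qpoch_inf p p ^ 2 * (\<Sum>i. q * p ^ i / (1 - q * p ^ i) ^ 2))) (at 0)"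
    using DERIV_cdivide[OF P(3), of "qpoch_inf p p ^ 2"] by (simp add: P(2))
  \<comment> \<open>All derivatives here are negative, on both sides; the signs are removed at the
    end.\<close>
  have "(\<lambda>n. - (base_weight q n *
      (even_factor ((q ^ 2) ^ n) (X n) 0 * (3 * odd_sum q n)
            + ((q ^ 2) ^ n) ^ 2 * X n * (1 + 2 * X n + 3 * X n ^ 2) / ((1 - X n) * (1 + X n) ^ 3))))
      sums - (qpoch_inf q p ^ 2 / qpoch_inf p p ^ 2 * (\<Sum>i. q * p ^ i / (1 - q * p ^ i) ^ 2))"
    using sums_derivative_at_0[where f = F, OF r(1) M(1) _ holo deriv _ G] param by blast
  from sums_minus[OF this] show ?thesis unfolding p_def by simp
qed

section \<open>Assembly of the identity\<close>

lemma qint_term_eq: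
  assumes "norm q < 1"
  shows "q ^ n / qint q n ^ 2 = (1 - q) ^ 2 * (q ^ n / (1 - q ^ n) ^ 2)"
  by (simp add: qint_conv[OF assms] power_divide)

theorem theorem1p6:
  fixes q :: complex
  assumes "norm q < 1"
  shows "(\<lambda>k. q ^ (6 * k ^ 2) * (qpoch q (q ^ 2) k ^ 6 / qpoch (q ^ 2) (q ^ 2) (2 * k) ^ 3)
            * (lambda_q q k * (\<Sum>i=1..2*k. q ^ (2*i) / qint q (2*i) ^ 2)
               - mu_q q k * (\<Sum>i=1..k. q ^ (2*i - 1) / qint q (2*i - 1) ^ 2)
               - nu_q q k * (1 - q) * q ^ (1 + 6*k)))
         sums
         (qpoch_inf q (q ^ 2) * qpoch_inf (q ^ 3) (q ^ 2) / qpoch_inf (q ^ 2) (q ^ 2) ^ 2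
            * ((\<Sum>j. q ^ (2 * Suc j) / qint q (2 * Suc j) ^ 2)
               - 3 * (1 + q) ^ 3 / 64
                   * (\<Sum>j. q ^ (2 * Suc j - 1) / qint q (2 * Suc j - 1) ^ 2)))"
proof (cases "q = 0")
  \<comment> \<open>Treated separately because b = qt must be nonzero. At q = 0 every summand
    vanishes, at k = 0 because of the factor q^(1+6k) and the empty sums, and so does the right-hand
    side.\<close>
  case True
  show ?thesis (is "?f sums ?s")
  proof -
    have "?f = (\<lambda>_. 0)"
    proof
      fix k show "?f k = 0" using True by (cases k) (simp_all add: power_0_left)
    qed
    moreover have "?s = 0" using True by simp
    ultimately show ?thesis by (simp only: sums_zero)
  qed
next
  case False
  define c where "c = 3 * (1 + q) ^ 3 / 64"
  define p where "p = q ^ 2"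
  let ?R = "qpoch_inf q p ^ 2 / qpoch_inf p p ^ 2"
  define Y where "Y = (\<lambda>n. (p ^ n) ^ 2 * (q * p ^ n))"
  have p1: "norm p < 1"
    using assms by (simp add: p_def norm_power power_less_one_iff)
  have q1: "1 - q \<noteq> 0" using assms by auto
  have e: "q ^ (2 * Suc j) = p * p ^ j" and o: "q ^ (2 * Suc j - 1) = q * p ^ j" for j
    by (simp_all add: p_def power_mult power2_eq_square)
  have es: "q ^ (2 * Suc j) / qint q (2 * Suc j) ^ 2 = (1 - q) ^ 2 * (p * p ^ j / (1 - p * p ^ j) ^ 2)" for j
    by (subst qint_term_eq[OF assms]) (simp only: e)
  have os: "q ^ (2 * Suc j - 1) / qint q (2 * Suc j - 1) ^ 2 = (1 - q) ^ 2 * (q * p ^ j / (1 - q * p ^ j) ^ 2)" for j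
    by (subst qint_term_eq[OF assms]) (simp only: o)
  have even: "(\<Sum>i=1..2*k. q ^ (2*i) / qint q (2*i) ^ 2) = (1 - q) ^ 2 * even_sum q k" for k
    unfolding even_sum_def p_def [symmetric] sum_distrib_left es [symmetric]
    by (simp add: sum.atLeast1_atMost_eq)
  have odd: "(\<Sum>i=1..k. q ^ (2*i - 1) / qint q (2*i - 1) ^ 2) = (1 - q) ^ 2 * odd_sum q k" for k
    unfolding odd_sum_def p_def [symmetric] sum_distrib_left os [symmetric]
    by (simp add: sum.atLeast1_atMost_eq)
  have se: "summable (\<lambda>j. p * p ^ j / (1 - p * p ^ j) ^ 2)"
    using summable_mult[OF summable_qint_even[OF assms], of "1 / (1 - q) ^ 2"] q1 unfolding es by simp
  have so: "summable (\<lambda>j. q * p ^ j / (1 - q * p ^ j) ^ 2)"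
    using summable_mult[OF summable_qint_odd[OF assms], of "1 / (1 - q) ^ 2"] q1 unfolding os by simp
  \<comment> \<open>Splitting off the first factor replaces one of the two copies of
    (q;q^2)_\<infinity> by (1 - q)(q^3;q^2)_\<infinity>, as the stated product requires.\<close>
  have "(\<lambda>n. qpoch q p (Suc n)) \<longlonglongrightarrow> (1 - q) * qpoch_inf (q ^ 3) p"
  proof -
    have "qpoch q p (Suc n) = (1 - q) * qpoch (q ^ 3) p n" for n
      using qpoch_shift[of q p n] by (simp add: qpoch_Suc p_def power2_eq_square power3_eq_cube mult.assoc)
    thus ?thesis using tendsto_mult_left[OF qpoch_LIMSEQ[OF p1]] by simp
  qed
  hence q3: "qpoch_inf q p = (1 - q) * qpoch_inf (q ^ 3) p"
    using LIMSEQ_Suc[OF qpoch_LIMSEQ[OF p1]] LIMSEQ_unique by blast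
  \<comment> \<open>The outer factor 1 - q is what remains of (1 - q)^2, from the q-integers, after
    \<open>lambda_q\<close> has contributed 1/(1 - q).\<close>
  note S = sums_mult[OF sums_diff[OF even_series_sums[OF assms False]
    sums_mult[OF odd_series_sums[OF assms False], of c]], of "1 - q", folded p_def]
  have summand: "q ^ (6 * k ^ 2) * (qpoch q (q ^ 2) k ^ 6 / qpoch (q ^ 2) (q ^ 2) (2 * k) ^ 3)
            * (lambda_q q k * (\<Sum>i=1..2*k. q ^ (2*i) / qint q (2*i) ^ 2)
               - mu_q q k * (\<Sum>i=1..k. q ^ (2*i - 1) / qint q (2*i - 1) ^ 2)
               - nu_q q k * (1 - q) * q ^ (1 + 6*k))
       = (1 - q) * (base_weight q k * (even_factor (p ^ k) (q * p ^ k) 0 * (even_sum q k - 2 * odd_sum q k)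
            + (p ^ k) ^ 2 * (q * p ^ k) ^ 2 * (1 + q * p ^ k + (q * p ^ k) ^ 2) ^ 2 / ((1 - q * p ^ k) * (1 + q * p ^ k) ^ 5))
          - c * (base_weight q k * (even_factor (p ^ k) (q * p ^ k) 0 * (3 * odd_sum q k)
            + (p ^ k) ^ 2 * (q * p ^ k) * (1 + 2 * (q * p ^ k) + 3 * (q * p ^ k) ^ 2) / ((1 - q * p ^ k) * (1 + q * p ^ k) ^ 3))))" for k
  proof -
    define x X where "x = (q ^ 2) ^ k" and "X = q * x"
    have E: "even_factor x X 0 = (1 - q) * lambda_q q k"
      using even_factor_0_eq_lambda[OF assms, of k] by (simp add: x_def X_def)
    have mu: "mu_q q k = lambda_q q k * (2 + 3 * c)"
      using mu_q_eq[OF assms] by (simp add: c_def)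
    define g1 where "g1 = (1 + 2 * X + 3 * X ^ 2) / ((1 - X) * (1 + X) ^ 3)"
    define g2 where "g2 = (1 + X + X ^ 2) ^ 2 / ((1 - X) * (1 + X) ^ 5)"
    have nu: "nu_q q k = c * g1 - X * g2"
      unfolding nu_q_def power_conversions[OF x_def X_def] c_def g1_def g2_def by (simp add: mult_ac)
    have Xs: "p ^ k = x" "q * x = X" by (simp_all add: x_def X_def p_def)
    have g: "x ^ 2 * X ^ 2 * (1 + X + X ^ 2) ^ 2 / ((1 - X) * (1 + X) ^ 5) = x ^ 2 * X ^ 2 * g2"
      "x ^ 2 * X * (1 + 2 * X + 3 * X ^ 2) / ((1 - X) * (1 + X) ^ 3) = x ^ 2 * X * g1"
      by (simp_all add: g1_def g2_def)
    show ?thesis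
      unfolding even odd mu nu power_conversions(2)[OF x_def X_def] Xs E g base_weight_def [symmetric]
      by algebra
  qed
  \<comment> \<open>With d = 1 - q and Z = (q^3;q^2)_\<infinity> this balances the powers of 1 - q
    on the right-hand side: d^3 Z^2 on both sides.\<close>
  have gen: "d * Z * Z / r ^ 2 * (d ^ 2 * E - c * (d ^ 2 * O'))
      = d * ((d * Z) ^ 2 / r ^ 2 * E - c * ((d * Z) ^ 2 / r ^ 2 * O'))" for d Z r E O' :: complex
    by (simp add: divide_inverse power2_eq_square algebra_simps)
  have "qpoch_inf q (q ^ 2) * qpoch_inf (q ^ 3) (q ^ 2) / qpoch_inf (q ^ 2) (q ^ 2) ^ 2
            * ((\<Sum>j. q ^ (2 * Suc j) / qint q (2 * Suc j) ^ 2)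
               - 3 * (1 + q) ^ 3 / 64
                   * (\<Sum>j. q ^ (2 * Suc j - 1) / qint q (2 * Suc j - 1) ^ 2))
      = (1 - q) * (?R * (\<Sum>i. p * p ^ i / (1 - p * p ^ i) ^ 2)
          - c * (?R * (\<Sum>i. q * p ^ i / (1 - q * p ^ i) ^ 2)))"
    unfolding es os suminf_mult[OF se] suminf_mult[OF so] c_def [symmetric] p_def [symmetric] q3
    by (rule gen)
  with S show ?thesis unfolding summand by (simp only:)
qed

end
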